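(* Let $\Gamma$ be a graph with $n$ loops ($h_1(\Gamma)=n$) and $2n$ edges $e_1,\dots,e_{2n}$. Assume every (nonempty) proper subgraph $G\subsetneq \Gamma$ is convergent, i.e. satisfies $\#E_G>2h_1(G)$, and let $q_1,\dots,q_{2n}$ be the Feynman quadrics associated to $\Gamma$. The $4n\times 4n$ symmetric matrices $M_i$ of the $q_i$ are in this case block diagonal $$M_i=\begin{pmatrix}N_i&0&0&0\\0&N_i&0&0\\0&0&N_i&0\\0&0&0&N_i\end{pmatrix},$$ and $\Phi:=\det(A_1M_1+\cdots+A_{2n}M_{2n})$ equals $\Psi_\Gamma^4$, where $\Psi_\Gamma=\det(A_1N_1+\cdots+A_{2n}N_{2n})$ is the graph polynomial. The Schwinger trick yields $$P(\Gamma):=\int_{\mathbb{P}^{4n-1}(\mathbb{R})}\frac{\Omega_{4n-1}(Z)}{q_1q_2\cdots q_{2n}}=\frac{c}{\pi^{2n}}\int_{\sigma^{2n-1}(\mathbb{R})}\frac{\Omega_{2n-1}(A)}{\Psi_\Gamma^2}$$ for some $c\in\mathbb{Q}^\times$.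
   Context: Graphs are finite; subgraphs are identified with their edge sets and need not be connected; $E_G$ is the edge set of $G$ and $h_1$ is the first Betti number. Orient the edges, so $H_1(\Gamma,\mathbb{Z})\subset\mathbb{Z}[E]$ is the kernel of the boundary map $\mathbb{Z}[E]\to\mathbb{Z}[V]$, where $E$, $V$ are the sets of edges and vertices of $\Gamma$. Fix a $\mathbb{Z}$-basis of $H_1(\Gamma,\mathbb{Z})\cong\mathbb{Z}^n$, put $H=H_1(\Gamma,\mathbb{Q})$, and let $\ell_i:H\to\mathbb{Q}$ be the restriction of the coordinate functional $e_i^\vee$ of the edge $e_i$. $N_i$ is the $n\times n$ symmetric matrix of the quadratic form $\ell_i^2$ in this basis. The Feynman quadric of $e_i$ is given by the quadratic form $q_i(z_1,z_2,z_3,z_4)=\sum_{a=1}^4\ell_i(z_a)^2$ on $H^4$, in the corresponding coordinates $Z_1,\dots,Z_{4n}$ on $H^4$ (homogeneous coordinates on $\mathbb{P}^{4n-1}=\mathbb{P}(H^4)$). For homogeneous coordinates $Z_1,\dots,Z_m$, $\Omega_{m-1}(Z)=\sum_{i=1}^m(-1)^iZ_i\,dZ_1\wedge\cdots\widehat{dZ_i}\cdots\wedge dZ_m$. $\sigma^{2n-1}(\mathbb{R})\subset\mathbb{P}^{2n-1}(\mathbb{R})$ is the set of points representable by coordinates $A_1,\dots,A_{2n}$ all $\ge 0$. The "Schwinger trick" is the name of the method relating the first integral to the second.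
   Formalization: The formal statement has P(Γ) = c·π^{2n}·∫Ω/Ψ² instead of (c/π^{2n})·∫Ω/Ψ²; the printed power of π is wrong: for two vertices joined by two edges (n=1) P(Γ)=π² and the second integral is 1, forcing c=π⁴, which is irrational. *)

theory Defs
  imports
    "HOL-Analysis.Analysis"
    "HOL-Algebra.Free_Abelian_Groups"
    "Graph_Theory.Digraph"
    "Jordan_Normal_Form.Determinant"
begin

hide_const (open) Determinants.det Finite_Cartesian_Product.vec Finite_Cartesian_Product.mat
no_notation vec_nth (infixl \<open>$\<close> 90)

section \<open>Homology of an oriented graph\<close>

text \<open>A finite graph with oriented edges is a finite digraph (loops and multiple edges allowed);
  \<open>\<int>[E]\<close> and \<open>\<int>[V]\<close> are free abelian groups of finitely supported functions. A subgraph is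
  its set of edges.\<close>

definition boundary :: "('v, 'e) pre_digraph \<Rightarrow> ('e \<Rightarrow>\<^sub>0 int) \<Rightarrow> ('v \<Rightarrow>\<^sub>0 int)" where
  "boundary G = frag_extend (\<lambda>a. frag_of (head G a) - frag_of (tail G a))"

definition H1 :: "('v, 'e) pre_digraph \<Rightarrow> 'e set \<Rightarrow> ('e \<Rightarrow>\<^sub>0 int) set" where
  "H1 G S = {x. Poly_Mapping.keys x \<subseteq> S \<and> boundary G x = 0}"

text \<open>The first Betti number is the rank of the abelian group \<open>H1 G S\<close>. The maximum exists for
  finite \<open>S\<close>: independent subsets of \<open>H1 G S\<close> have at most \<open>card S\<close> elements.\<close>

definition betti1 :: "('v, 'e) pre_digraph \<Rightarrow> 'e set \<Rightarrow> nat" where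
  "betti1 G S = Max {card B |B. finite B \<and> B \<subseteq> H1 G S \<and> \<not> module.dependent frag_cmul B}"

definition convergent_subgraph :: "('v, 'e) pre_digraph \<Rightarrow> 'e set \<Rightarrow> bool" where
  "convergent_subgraph G S \<longleftrightarrow> card S > 2 * betti1 G S"

definition H1_basis :: "('v, 'e) pre_digraph \<Rightarrow> nat \<Rightarrow> (nat \<Rightarrow> 'e \<Rightarrow>\<^sub>0 int) \<Rightarrow> bool" where
  "H1_basis G n b \<longleftrightarrow> inj_on b {..<n} \<and> \<not> module.dependent frag_cmul (b ` {..<n})
     \<and> module.span frag_cmul (b ` {..<n}) = H1 G (arcs G)"

section \<open>Quadratic forms of the edges\<close>

text \<open>The edge functional evaluated at the class \<open>\<Sum>j<n. z\<^sub>j b\<^sub>j\<close>, with scalars extended from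
  \<open>\<rat>\<close> to \<open>\<real>\<close>.\<close>

definition edge_form :: "nat \<Rightarrow> (nat \<Rightarrow> 'e \<Rightarrow>\<^sub>0 int) \<Rightarrow> 'e \<Rightarrow> real vec \<Rightarrow> real" where
  "edge_form n b a z = (\<Sum>j<n. z $ j * of_int (Poly_Mapping.lookup (b j) a))"

text \<open>The coordinates of \<open>(z\<^sub>1, \<dots>, z\<^sub>4) \<in> H\<^sup>4\<close> are concatenated: \<open>z\<^sub>1\<close> first, then \<open>z\<^sub>2\<close>, etc.\<close>

definition feynman_quadric :: "nat \<Rightarrow> (nat \<Rightarrow> 'e \<Rightarrow>\<^sub>0 int) \<Rightarrow> 'e \<Rightarrow> real vec \<Rightarrow> real" where
  "feynman_quadric n b a Z = (\<Sum>p<4. (edge_form n b a (vec n (\<lambda>j. Z $ (p * n + j))))\<^sup>2)"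

definition sym_matrix_of :: "nat \<Rightarrow> (real vec \<Rightarrow> real) \<Rightarrow> real mat" where
  "sym_matrix_of d q = (THE Q. Q \<in> carrier_mat d d \<and> transpose_mat Q = Q
     \<and> (\<forall>x\<in>carrier_vec d. q x = x \<bullet> (Q *\<^sub>v x)))"

definition N_mat :: "nat \<Rightarrow> (nat \<Rightarrow> 'e \<Rightarrow>\<^sub>0 int) \<Rightarrow> 'e \<Rightarrow> real mat" where
  "N_mat n b a = sym_matrix_of n (\<lambda>z. (edge_form n b a z)\<^sup>2)"

definition M_mat :: "nat \<Rightarrow> (nat \<Rightarrow> 'e \<Rightarrow>\<^sub>0 int) \<Rightarrow> 'e \<Rightarrow> real mat" where
  "M_mat n b a = sym_matrix_of (4 * n) (feynman_quadric n b a)"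

text \<open>The matrix \<open>A\<^sub>1 Q\<^sub>1 + \<dots> + A\<^sub>r Q\<^sub>r\<close> of size \<open>d\<close>.\<close>

definition mat_pencil :: "nat \<Rightarrow> nat \<Rightarrow> (nat \<Rightarrow> real mat) \<Rightarrow> real vec \<Rightarrow> real mat" where
  "mat_pencil d r Q A = mat d d (\<lambda>(i, j). \<Sum>k<r. A $ k * Q k $$ (i, j))"

definition Psi :: "nat \<Rightarrow> (nat \<Rightarrow> 'e \<Rightarrow>\<^sub>0 int) \<Rightarrow> (nat \<Rightarrow> 'e) \<Rightarrow> real vec \<Rightarrow> real" where
  "Psi n b e A = det (mat_pencil n (2 * n) (\<lambda>i. N_mat n b (e i)) A)"

definition Phi :: "nat \<Rightarrow> (nat \<Rightarrow> 'e \<Rightarrow>\<^sub>0 int) \<Rightarrow> (nat \<Rightarrow> 'e) \<Rightarrow> real vec \<Rightarrow> real" where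
  "Phi n b e A = det (mat_pencil (4 * n) (2 * n) (\<lambda>i. M_mat n b (e i)) A)"

section \<open>Integrals over real projective space\<close>

text \<open>The form \<open>\<Sum>i=1..m. (-1)\<^sup>i Z\<^sub>i dZ\<^sub>1 \<and> \<dots> \<and> dZ\<^sub>m\<close> (with \<open>dZ\<^sub>i\<close> omitted) at the point \<open>Z\<close>,
  applied to the tangent vectors \<open>v 0, \<dots>, v (m - 2)\<close>. Indices are shifted to start at 0.\<close>

definition Omega :: "nat \<Rightarrow> real vec \<Rightarrow> (nat \<Rightarrow> real vec) \<Rightarrow> real" where
  "Omega m Z v = (\<Sum>i<m. (-1) ^ Suc i * Z $ i *
     det (mat (m - 1) (m - 1) (\<lambda>(r, c). v r $ insert_index i c)))"

text \<open>Points of \<open>\<P>\<^sup>m\<^sup>-\<^sup>1(\<real>)\<close> are given by nonzero vectors up to scaling, subsets by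
  scaling-invariant sets of such vectors.\<close>

definition proj_points :: "nat \<Rightarrow> real vec set" where
  "proj_points m = carrier_vec m - {0\<^sub>v m}"

definition sigma_points :: "nat \<Rightarrow> real vec set" where
  "sigma_points m = {Z \<in> proj_points m. \<exists>t. t \<noteq> 0 \<and> (\<forall>i<m. (t \<cdot>\<^sub>v Z) $ i \<ge> 0)}"

definition chart :: "nat \<Rightarrow> (nat \<Rightarrow> real) \<Rightarrow> real vec" where
  "chart m x = vec m (\<lambda>i. if i < m - 1 then x i else 1)"

text \<open>The integral of the form \<open>f \<Omega>\<close> over the subset \<open>X\<close> of projective space, for \<open>f\<close>
  homogeneous of degree \<open>-m\<close>. The affine chart where the last coordinate is 1 omits only a
  hyperplane, a null set; the form is pulled back along it (the partial derivatives of \<open>chart m\<close>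
  are unit vectors) and integrated against Lebesgue measure on \<open>\<real>\<^sup>m\<^sup>-\<^sup>1\<close>, which orients \<open>X\<close> by the
  chart.\<close>

definition proj_integrand :: "nat \<Rightarrow> (real vec \<Rightarrow> real) \<Rightarrow> (nat \<Rightarrow> real) \<Rightarrow> real" where
  "proj_integrand m f x = f (chart m x) * Omega m (chart m x) (unit_vec m)"

definition chart_measure :: "nat \<Rightarrow> (nat \<Rightarrow> real) measure" where
  "chart_measure m = (\<Pi>\<^sub>M i\<in>{..<m - 1}. lborel)"

definition chart_domain :: "nat \<Rightarrow> real vec set \<Rightarrow> (nat \<Rightarrow> real) set" where
  "chart_domain m X = {x \<in> space (chart_measure m). chart m x \<in> X}"

definition proj_integrable :: "nat \<Rightarrow> real vec set \<Rightarrow> (real vec \<Rightarrow> real) \<Rightarrow> bool" where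
  "proj_integrable m X f \<longleftrightarrow>
     set_integrable (chart_measure m) (chart_domain m X) (proj_integrand m f)"

definition proj_integral :: "nat \<Rightarrow> real vec set \<Rightarrow> (real vec \<Rightarrow> real) \<Rightarrow> real" where
  "proj_integral m X f =
     set_lebesgue_integral (chart_measure m) (chart_domain m X) (proj_integrand m f)"

text \<open>The integrals \<open>P(\<Gamma>)\<close> and \<open>\<integral> \<Omega>(A) / \<Psi>\<^sup>2\<close> are those of the following functions over
  \<open>proj_points (4 * n)\<close> and \<open>sigma_points (2 * n)\<close>. The Gaussian integral
  \<open>\<integral> exp (- \<Sum>i. A\<^sub>i q\<^sub>i(Z)) dZ = \<pi>\<^sup>2\<^sup>n / \<surd>\<Phi>(A)\<close> over \<open>\<real>\<^sup>4\<^sup>n\<close> makes the first a rational multiple of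
  \<open>\<pi>\<^sup>2\<^sup>n\<close> times the second (the factor \<open>\<pi>\<^sup>-\<^sup>2\<^sup>n\<close> found in the
  literature belongs on the other side): for two vertices joined by two edges, \<open>n = 1\<close>, they equal \<open>\<pi>\<^sup>2\<close> and \<open>1\<close>.\<close>

definition momentum_integrand ::
    "nat \<Rightarrow> (nat \<Rightarrow> 'e \<Rightarrow>\<^sub>0 int) \<Rightarrow> (nat \<Rightarrow> 'e) \<Rightarrow> real vec \<Rightarrow> real" where
  "momentum_integrand n b e Z = 1 / (\<Prod>i<2 * n. feynman_quadric n b (e i) Z)"

definition parametric_integrand ::
    "nat \<Rightarrow> (nat \<Rightarrow> 'e \<Rightarrow>\<^sub>0 int) \<Rightarrow> (nat \<Rightarrow> 'e) \<Rightarrow> real vec \<Rightarrow> real" where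
  "parametric_integrand n b e A = 1 / (Psi n b e A)\<^sup>2"

end

theory Submission
  imports "HOL-Probability.Distributions" Defs
begin

text \<open>
  Feynman's parametrization writes \<open>1 / (q\<^sub>1 \<cdots> q\<^sub>2\<^sub>n)\<close> as an integral of
  \<open>t\<^sup>2\<^sup>n\<^sup>-\<^sup>1 exp (- t (\<Sum>k. a\<^sub>k q\<^sub>k))\<close> over the scale \<open>t > 0\<close> and over positive \<open>a\<close> with last coordinate 1,
  which are affine coordinates on the simplex. Integrating first over the chart of \<open>\<P>\<^sup>4\<^sup>n\<^sup>-\<^sup>1\<close> (a Gaussian
  integral) and then over \<open>t\<close> gives exactly \<open>\<pi>\<^sup>2\<^sup>n / \<surd>\<Phi>(a) = \<pi>\<^sup>2\<^sup>n / \<Psi>(a)\<^sup>2\<close>. All integrands are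
  nonnegative, so Tonelli applies and \<open>c = 1\<close>; what remains is that the parametric integral converges.

  For that, order the edges by decreasing \<open>a\<close> and choose greedily a basis \<open>B\<close> of the dual of \<open>H\<^sub>1\<close> among
  the edge functionals. Dropping the other edges bounds \<open>\<Psi>\<close> below by \<open>\<Prod>k\<in>B. a\<^sub>k\<close>, and convergence of
  the subgraph formed by the edges after the \<open>m\<close>-th says that more than \<open>m / 2\<close> of the first \<open>m\<close> edges
  lie in \<open>B\<close>. Summation by parts turns this into
  \<open>\<Psi>(a)\<^sup>2 \<ge> (max a / min a) \<Prod>k. a\<^sub>k\<close>, and in logarithmic coordinates \<open>1 / \<Psi>\<^sup>2\<close> is then dominated by a
  product of exponentially decaying functions.
\<close>

section \<open>Symmetric matrices of quadratic forms, and repeated diagonal blocks\<close>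

lemma sum_blocks:
  fixes f :: "nat \<Rightarrow> 'a::comm_monoid_add"
  shows "(\<Sum>r<p * n. f r) = (\<Sum>q<p. \<Sum>j<n. f (q * n + j))"
proof -
  have "(\<Sum>j<n. f (q * n + j)) = sum f {q * n..<q * n + n}" for q
    using sum.shift_bounds_nat_ivl[of f 0 "q * n" n] by (simp add: atLeast0LessThan add.commute)
  then show ?thesis
    by (simp add: sum.nat_group)
qed

lemma quadratic_form_eq_sum:
  fixes Q :: "real mat"
  assumes "Q \<in> carrier_mat d d" "x \<in> carrier_vec d"
  shows "x \<bullet> (Q *\<^sub>v x) = (\<Sum>i<d. \<Sum>j<d. Q $$ (i, j) * x $ i * x $ j)"
  using assms
  by (auto simp: scalar_prod_def mult_mat_vec_def row_def atLeast0LessThan sum_distrib_left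
      intro!: sum.cong)

text \<open>Polarization: the difference \<open>D\<close> of the coefficients gives the zero form.
  Unit vectors show that its diagonal vanishes, and a sum of two unit vectors then leaves
  \<open>D i j + D j i\<close>, twice the entry by symmetry.\<close>

lemma quadratic_form_determines:
  fixes P Q :: "nat \<Rightarrow> nat \<Rightarrow> real"
  assumes sym: "\<And>i j. i < d \<Longrightarrow> j < d \<Longrightarrow> P i j = P j i" "\<And>i j. i < d \<Longrightarrow> j < d \<Longrightarrow> Q i j = Q j i"
    and eq: "\<And>x. (\<Sum>i<d. \<Sum>j<d. P i j * x i * x j) = (\<Sum>i<d. \<Sum>j<d. Q i j * x i * x j)"
    and ij: "i < d" "j < d"
  shows "P i j = Q i j"
proof -
  define D where "D k l = P k l - Q k l" for k l
  have D0: "(\<Sum>k<d. \<Sum>l<d. D k l * x k * x l) = 0" for x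
    using eq[of x] by (simp add: D_def algebra_simps sum_subtractf)
  have e: "(\<Sum>k<d. \<Sum>l<d. D k l * (if k = a then 1 else 0) * (if l = c then 1 else 0)) = D a c"
    if "a < d" "c < d" for a c
  proof -
    have "D k l * (if k = a then 1 else 0) * (if l = c then 1 else 0) =
        (if l = c then if k = a then D a c else 0 else 0)" for k l
      by simp
    then show ?thesis
      using that by (simp add: sum.delta)
  qed
  have diag: "D a a = 0" if "a < d" for a
    using e[OF that that] D0[of "\<lambda>k. if k = a then 1 else 0"] by simp
  have "0 = (\<Sum>k<d. \<Sum>l<d. D k l * ((if k = i then 1 else 0) + (if k = j then 1 else 0))
      * ((if l = i then 1 else 0) + (if l = j then 1 else 0)))"
    using D0[of "\<lambda>k. (if k = i then 1 else 0) + (if k = j then 1 else 0)"] by simp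
  also have "\<dots> = D i i + D i j + (D j i + D j j)"
    unfolding distrib_left distrib_right sum.distrib using e ij by simp
  finally show ?thesis
    using diag ij sym by (simp add: D_def)
qed

text \<open>Polarization supplies the uniqueness that the definite description demands. Both
  \<open>N_mat\<close> and \<open>M_mat\<close> are computed by exhibiting a matrix here.\<close>

lemma sym_matrix_of_eqI:
  assumes Q: "Q \<in> carrier_mat d d" "transpose_mat Q = Q"
    and q: "\<And>x. x \<in> carrier_vec d \<Longrightarrow> q x = x \<bullet> (Q *\<^sub>v x)"
  shows "sym_matrix_of d q = Q"
  unfolding sym_matrix_of_def
proof (rule the_equality)
  show "Q \<in> carrier_mat d d \<and> transpose_mat Q = Q \<and> (\<forall>x\<in>carrier_vec d. q x = x \<bullet> (Q *\<^sub>v x))"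
    using assms by blast
next
  fix P assume P: "P \<in> carrier_mat d d \<and> transpose_mat P = P \<and> (\<forall>x\<in>carrier_vec d. q x = x \<bullet> (P *\<^sub>v x))"
  have sym: "A $$ (i, j) = A $$ (j, i)" if "A \<in> carrier_mat d d" "transpose_mat A = A" "i < d" "j < d"
    for A :: "real mat" and i j
    using that by (metis carrier_matD index_transpose_mat(1))
  have "P $$ (i, j) = Q $$ (i, j)" if "i < d" "j < d" for i j
  proof (rule quadratic_form_determines[where P = "\<lambda>i j. P $$ (i, j)" and Q = "\<lambda>i j. Q $$ (i, j)"])
    show "(\<Sum>i<d. \<Sum>j<d. P $$ (i, j) * x i * x j) = (\<Sum>i<d. \<Sum>j<d. Q $$ (i, j) * x i * x j)" for x
      using quadratic_form_eq_sum[of P d "vec d x"] quadratic_form_eq_sum[of Q d "vec d x"] P Q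
        q[of "vec d x"] by simp
  qed (use sym P Q that in auto)
  then show "P = Q"
    using P Q by (intro eq_matI) auto
qed

text \<open>The number of copies is left open; it is fixed by the size at which the entries are
  read. The entries are linear in \<open>f\<close>, so a pencil of block matrices is the block
  matrix of a pencil.\<close>

definition block_power :: "nat \<Rightarrow> (nat \<Rightarrow> nat \<Rightarrow> real) \<Rightarrow> nat \<Rightarrow> nat \<Rightarrow> real" where
  "block_power n f r s = (if r div n = s div n then f (r mod n) (s mod n) else 0)"

lemma block_power_quadratic_form:
  "(\<Sum>r<p * n. \<Sum>s<p * n. block_power n f r s * x r * x s) =
   (\<Sum>q<p. \<Sum>i<n. \<Sum>j<n. f i j * x (q * n + i) * x (q * n + j))"
proof -
  have "(\<Sum>t<p. \<Sum>j<n. block_power n f (q * n + i) (t * n + j) * x (q * n + i) * x (t * n + j)) =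
      (\<Sum>j<n. f i j * x (q * n + i) * x (q * n + j))" if "q < p" "i < n" for q i
  proof -
    have "(\<Sum>j<n. block_power n f (q * n + i) (t * n + j) * x (q * n + i) * x (t * n + j)) =
        (if t = q then \<Sum>j<n. f i j * x (q * n + i) * x (q * n + j) else 0)" for t
      using that by (simp add: block_power_def)
    then show ?thesis
      using that by (simp add: sum.delta)
  qed
  then show ?thesis
    by (simp add: sum_blocks)
qed

lemma block_power_sym:
  assumes "\<And>i j. i < n \<Longrightarrow> j < n \<Longrightarrow> f i j = f j i" "n > 0"
  shows "block_power n f r s = block_power n f s r"
  using assms by (simp add: block_power_def)

text \<open>Subtracting \<open>n\<close> from an index that is at least \<open>n\<close> lowers its
  quotient by one and keeps its remainder, so what remains after the first block is again a block
  power. This recursion gives both the comparison with \<open>diag_block_mat\<close> and the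
  determinant.\<close>

lemma block_power_Suc:
  assumes "n > 0"
  shows "mat (Suc p * n) (Suc p * n) (\<lambda>(r, s). block_power n f r s) =
    four_block_mat (mat n n (\<lambda>(i, j). f i j)) (0\<^sub>m n (p * n)) (0\<^sub>m (p * n) n)
      (mat (p * n) (p * n) (\<lambda>(r, s). block_power n f r s))"
  using assms
  by (intro eq_matI)
    (auto simp: block_power_def le_div_geq le_mod_geq not_less div_eq_0_iff)

lemma diag_block_mat_replicate:
  assumes "n > 0"
  shows "diag_block_mat (replicate p (mat n n (\<lambda>(i, j). f i j))) =
    mat (p * n) (p * n) (\<lambda>(r, s). block_power n f r s)"
proof (induction p)
  case 0
  then show ?case by (auto intro!: eq_matI)
next
  case (Suc p)
  then show ?case
    unfolding block_power_Suc[OF assms] by (simp add: Let_def)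
qed

lemma det_block_power:
  assumes "n > 0"
  shows "det (mat (p * n) (p * n) (\<lambda>(r, s). block_power n f r s)) = det (mat n n (\<lambda>(i, j). f i j)) ^ p"
proof (induction p)
  case 0
  then show ?case by (simp add: det_def)
next
  case (Suc p)
  show ?case
    unfolding block_power_Suc[OF assms]
    by (subst det_four_block_mat_upper_right_zero[where n = n and m = "p * n"]) (auto simp: Suc)
qed

section \<open>The matrices of the edges\<close>

text \<open>Coordinate \<open>j\<close> of the functional of the edge \<open>a\<close> in the basis
  dual to \<open>b\<close>, over the reals. The matrix of the squared functional is the outer
  product of this coordinate vector with itself.\<close>

definition edge_coeff :: "(nat \<Rightarrow> 'e \<Rightarrow>\<^sub>0 int) \<Rightarrow> 'e \<Rightarrow> nat \<Rightarrow> real" where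
  "edge_coeff b a j = of_int (Poly_Mapping.lookup (b j) a)"

lemma edge_form_square:
  "(edge_form n b a z)\<^sup>2 = (\<Sum>i<n. \<Sum>j<n. edge_coeff b a i * edge_coeff b a j * z $ i * z $ j)"
  by (simp add: edge_form_def edge_coeff_def power2_eq_square sum_product ac_simps)

lemma feynman_quadric_eq:
  "feynman_quadric n b a Z =
    (\<Sum>r<4 * n. \<Sum>s<4 * n. block_power n (\<lambda>i j. edge_coeff b a i * edge_coeff b a j) r s * Z $ r * Z $ s)"
  unfolding block_power_quadratic_form feynman_quadric_def edge_form_square by simp

lemma N_mat_eq: "N_mat n b a = mat n n (\<lambda>(i, j). edge_coeff b a i * edge_coeff b a j)"
  unfolding N_mat_def
  by (rule sym_matrix_of_eqI)
    (auto simp: quadratic_form_eq_sum[where d = n] edge_form_square intro!: eq_matI sum.cong)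

lemma M_mat_eq:
  assumes "n > 0"
  shows "M_mat n b a = mat (4 * n) (4 * n)
    (\<lambda>(r, s). block_power n (\<lambda>i j. edge_coeff b a i * edge_coeff b a j) r s)"
  unfolding M_mat_def
proof (rule sym_matrix_of_eqI)
  show "transpose_mat (mat (4 * n) (4 * n)
      (\<lambda>(r, s). block_power n (\<lambda>i j. edge_coeff b a i * edge_coeff b a j) r s)) =
    mat (4 * n) (4 * n) (\<lambda>(r, s). block_power n (\<lambda>i j. edge_coeff b a i * edge_coeff b a j) r s)"
    by (intro eq_matI) (auto simp: block_power_def)
qed (auto simp: quadratic_form_eq_sum[where d = "4 * n"] feynman_quadric_eq intro!: sum.cong)

lemma M_mat_block:
  assumes "n > 0"
  shows "M_mat n b a = diag_block_mat [N_mat n b a, N_mat n b a, N_mat n b a, N_mat n b a]"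
  using diag_block_mat_replicate[OF assms, of 4 "\<lambda>i j. edge_coeff b a i * edge_coeff b a j"]
  by (simp add: M_mat_eq[OF assms] N_mat_eq numeral_eq_Suc)

text \<open>The matrix \<open>L^T diag(a) L\<close>, where the rows of \<open>L\<close> are the edge
  functionals; its determinant is the graph polynomial. The parameters form a function, so that
  chart coordinates and weights with zeros can be inserted alike.\<close>

definition edge_gram :: "nat \<Rightarrow> (nat \<Rightarrow> 'e \<Rightarrow>\<^sub>0 int) \<Rightarrow> (nat \<Rightarrow> 'e) \<Rightarrow> (nat \<Rightarrow> real) \<Rightarrow> nat \<Rightarrow> nat \<Rightarrow> real" where
  "edge_gram n b e a i j = (\<Sum>k<2 * n. a k * (edge_coeff b (e k) i * edge_coeff b (e k) j))"

lemma Psi_eq: "Psi n b e A = det (mat n n (\<lambda>(i, j). edge_gram n b e (\<lambda>k. A $ k) i j))"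
  unfolding Psi_def mat_pencil_def by (rule arg_cong[of _ _ det]) (auto simp: N_mat_eq edge_gram_def)

lemma Phi_eq:
  assumes "n > 0"
  shows "Phi n b e A =
    det (mat (4 * n) (4 * n) (\<lambda>(r, s). block_power n (edge_gram n b e (\<lambda>k. A $ k)) r s))"
  unfolding Phi_def mat_pencil_def
  by (rule arg_cong[of _ _ det])
    (use assms in \<open>auto simp: M_mat_eq block_power_def edge_gram_def intro!: eq_matI\<close>)

lemma Phi_eq_Psi_power: "n > 0 \<Longrightarrow> Phi n b e A = Psi n b e A ^ 4"
  by (simp add: Phi_eq Psi_eq det_block_power)

section \<open>Gaussian integrals of positive definite forms\<close>

text \<open>Permuting the rows and permuting the columns contribute \<open>signof p\<close> each,
  and the two signs cancel.\<close>

lemma det_mat_permute: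
  fixes M :: "nat \<Rightarrow> nat \<Rightarrow> real"
  assumes p: "p permutes {0..<d}"
  shows "det (mat d d (\<lambda>(i, j). M (p i) (p j))) = det (mat d d (\<lambda>(i, j). M i j))"
proof -
  have pd: "p i < d" if "i < d" for i
    using permutes_in_image[OF p, of i] that by simp
  define B where "B = mat d d (\<lambda>(i, j). M i (p j))"
  have "det (mat d d (\<lambda>(i, j). M (p i) (p j))) = det (mat d d (\<lambda>(i, j). B $$ (p i, j)))"
    by (rule arg_cong[of _ _ det]) (auto simp: B_def pd)
  also have "\<dots> = signof p * det B"
    by (rule det_permute_rows[OF _ p]) (simp add: B_def)
  also have "det B = det (transpose_mat B)"
    by (rule det_transpose[symmetric, of _ d]) (simp add: B_def)
  also have "transpose_mat B = mat d d (\<lambda>(i, j). (mat d d (\<lambda>(i, j). M j i)) $$ (p i, j))"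
    by (auto simp: B_def pd)
  also have "det \<dots> = signof p * det (mat d d (\<lambda>(i, j). M j i))"
    by (rule det_permute_rows[OF _ p]) simp
  also have "mat d d (\<lambda>(i, j). M j i) = transpose_mat (mat d d (\<lambda>(i, j). M i j))"
    by auto
  also have "det \<dots> = det (mat d d (\<lambda>(i, j). M i j))"
    by (rule det_transpose[of _ d]) simp
  finally show ?thesis
    by (simp add: sign_def)
qed

section \<open>Elimination of the last variable of a quadratic form\<close>

definition quad :: "nat \<Rightarrow> (nat \<Rightarrow> nat \<Rightarrow> real) \<Rightarrow> (nat \<Rightarrow> real) \<Rightarrow> real" where
  "quad d M v = (\<Sum>i<d. \<Sum>j<d. M i j * v i * v j)"

definition pos_def :: "nat \<Rightarrow> (nat \<Rightarrow> nat \<Rightarrow> real) \<Rightarrow> bool" where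
  "pos_def d M \<longleftrightarrow> (\<forall>i<d. \<forall>j<d. M i j = M j i) \<and> (\<forall>v. (\<exists>i<d. v i \<noteq> 0) \<longrightarrow> quad d M v > 0)"

text \<open>The Schur complement of the last diagonal entry.\<close>

definition schur :: "nat \<Rightarrow> (nat \<Rightarrow> nat \<Rightarrow> real) \<Rightarrow> nat \<Rightarrow> nat \<Rightarrow> real" where
  "schur d M i j = M i j - M i d * M d j / M d d"

lemma quad_cong: "(\<And>i. i < d \<Longrightarrow> v i = w i) \<Longrightarrow> quad d M v = quad d M w"
  unfolding quad_def by (intro sum.cong) auto

text \<open>Completing the square in the variable \<open>v d\<close>; the part of the square without
  \<open>v d\<close> is what the Schur complement subtracts.\<close>

lemma quad_Suc_eq_schur:
  assumes sym: "\<forall>i<Suc d. \<forall>j<Suc d. M i j = M j i" and "M d d \<noteq> 0"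
  shows "quad (Suc d) M v =
    quad d (schur d M) v + M d d * (v d + (\<Sum>i<d. M i d * v i) / M d d)\<^sup>2"
proof -
  define s where "s = (\<Sum>i<d. M i d * v i)"
  have "(\<Sum>i<d. M i d * v i * v d) = s * v d"
    by (simp add: s_def sum_distrib_right)
  moreover have "(\<Sum>i<d. M d i * v d * v i) = s * v d"
    using sym by (auto simp: s_def sum_distrib_left ac_simps intro!: sum.cong)
  ultimately have Q: "quad (Suc d) M v = quad d M v + s * v d + (s * v d + M d d * v d * v d)"
    by (simp add: quad_def sum.distrib)
  have "(\<Sum>i<d. \<Sum>j<d. M i d * M d j / M d d * v i * v j) = s * s / M d d"
    using sym by (auto simp: s_def sum_product sum_divide_distrib ac_simps intro!: sum.cong)
  then have "quad d (schur d M) v = quad d M v - s * s / M d d"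
    by (simp add: quad_def schur_def left_diff_distrib sum_subtractf)
  moreover have "M d d * (v d + s / M d d)\<^sup>2 = M d d * v d * v d + 2 * s * v d + s * s / M d d"
    using assms(2) by (simp add: power2_eq_square field_simps)
  ultimately show ?thesis
    unfolding s_def[symmetric] using Q by simp
qed

lemma pos_def_pivot:
  assumes "pos_def (Suc d) M"
  shows "M d d > 0"
proof -
  have "(\<Sum>i<Suc d. \<Sum>j<Suc d. M i j * of_bool (i = d) * of_bool (j = d)) = M d d"
    by (simp add: sum.delta)
  moreover have "quad (Suc d) M (\<lambda>i. of_bool (i = d)) > 0"
    using assms unfolding pos_def_def by (auto intro!: exI[of _ d])
  ultimately show ?thesis
    by (simp add: quad_def)
qed

lemma pos_def_schur:
  assumes "pos_def (Suc d) M"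
  shows "pos_def d (schur d M)"
  unfolding pos_def_def
proof (intro conjI allI impI)
  have sym: "\<forall>i<Suc d. \<forall>j<Suc d. M i j = M j i"
    using assms by (auto simp: pos_def_def)
  then show "schur d M i j = schur d M j i" if "i < d" "j < d" for i j
    using that by (simp add: schur_def)
  fix v :: "nat \<Rightarrow> real" assume v: "\<exists>i<d. v i \<noteq> 0"
  \<comment> \<open>This last coordinate makes the completed square vanish, so the full form at
    \<open>w\<close> equals the Schur form at \<open>v\<close>.\<close>
  define w where "w = v(d := - (\<Sum>i<d. M i d * v i) / M d d)"
  have "quad (Suc d) M w > 0"
  proof -
    obtain i where "i < d" "v i \<noteq> 0"
      using v by blast
    then have "\<exists>i<Suc d. w i \<noteq> 0"
      by (intro exI[of _ i]) (auto simp: w_def)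
    then show ?thesis
      using assms by (simp add: pos_def_def)
  qed
  also have "quad (Suc d) M w = quad d (schur d M) w"
    using pos_def_pivot[OF assms] by (subst quad_Suc_eq_schur[OF sym]) (auto simp: w_def)
  also have "\<dots> = quad d (schur d M) v"
    by (rule quad_cong) (simp add: w_def)
  finally show "quad d (schur d M) v > 0" .
qed

text \<open>One step of block elimination: the matrix is \<open>U * L\<close> with \<open>U\<close>
  upper unitriangular and \<open>L\<close> block lower triangular with diagonal blocks the Schur
  complement and the pivot.\<close>

lemma det_Suc_eq_schur:
  assumes "M d d \<noteq> 0"
  shows "det (mat (Suc d) (Suc d) (\<lambda>(i, j). M i j)) = M d d * det (mat d d (\<lambda>(i, j). schur d M i j))"
proof -
  define U where "U = four_block_mat (1\<^sub>m d) (mat d 1 (\<lambda>(i, _). M i d / M d d)) (0\<^sub>m 1 d) (1\<^sub>m 1)"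
  define L where "L = four_block_mat (mat d d (\<lambda>(i, j). schur d M i j)) (0\<^sub>m d 1)
    (mat 1 d (\<lambda>(_, j). M d j)) (mat 1 1 (\<lambda>_. M d d))"
  have "mat (Suc d) (Suc d) (\<lambda>(i, j). M i j) = U * L"
  proof -
    have "U * L = four_block_mat
        (1\<^sub>m d * mat d d (\<lambda>(i, j). schur d M i j) + mat d 1 (\<lambda>(i, _). M i d / M d d) * mat 1 d (\<lambda>(_, j). M d j))
        (1\<^sub>m d * 0\<^sub>m d 1 + mat d 1 (\<lambda>(i, _). M i d / M d d) * mat 1 1 (\<lambda>_. M d d))
        (0\<^sub>m 1 d * mat d d (\<lambda>(i, j). schur d M i j) + 1\<^sub>m 1 * mat 1 d (\<lambda>(_, j). M d j))
        (0\<^sub>m 1 d * 0\<^sub>m d 1 + 1\<^sub>m 1 * mat 1 1 (\<lambda>_. M d d))"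
      unfolding U_def L_def by (rule mult_four_block_mat) auto
    also have "\<dots> = mat (Suc d) (Suc d) (\<lambda>(i, j). M i j)"
      using assms
      by (intro eq_matI) (auto simp: scalar_prod_def schur_def less_Suc_eq)
    finally show ?thesis ..
  qed
  also have "det \<dots> = det U * det L"
    by (rule det_mult[where n = "Suc d"]) (auto simp: U_def L_def)
  also have "det U = 1"
    unfolding U_def by (subst det_four_block_mat_lower_left_zero[where n = d and m = 1]) auto
  also have "det L = M d d * det (mat d d (\<lambda>(i, j). schur d M i j))"
    unfolding L_def
    by (subst det_four_block_mat_upper_right_zero[where n = d and m = 1])
      (auto simp: det_single)
  finally show ?thesis by simp
qed

section \<open>Gaussian and Gamma integrals\<close>

lemma nn_integral_gaussian:
  assumes "c > 0"
  shows "(\<integral>\<^sup>+y. ennreal (exp (- (c * (y + h)\<^sup>2))) \<partial>lborel) = ennreal (sqrt (pi / c))"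
proof -
  \<comment> \<open>With this standard deviation the normal density centred at \<open>- h\<close>
    has the required exponent, and its normalizing factor is the inverse of
    \<open>sqrt (pi / c)\<close>.\<close>
  define s where "s = sqrt (1 / (2 * c))"
  have s: "s\<^sup>2 = 1 / (2 * c)" "s > 0"
    using assms by (simp_all add: s_def)
  have "exp (- (c * (y + h)\<^sup>2)) = sqrt (pi / c) * normal_density (- h) s y" for y
  proof -
    have "2 * pi * s\<^sup>2 = pi / c" "- (y - - h)\<^sup>2 / (2 * s\<^sup>2) = - (c * (y + h)\<^sup>2)"
      using assms by (simp_all add: s)
    then show ?thesis
      using assms by (simp add: normal_density_def)
  qed
  then have "(\<integral>\<^sup>+y. ennreal (exp (- (c * (y + h)\<^sup>2))) \<partial>lborel) =
      (\<integral>\<^sup>+y. ennreal (sqrt (pi / c) * normal_density (- h) s y) \<partial>lborel)"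
    by simp
  also have "\<dots> = ennreal (\<integral>y. sqrt (pi / c) * normal_density (- h) s y \<partial>lborel)"
    using assms s by (intro nn_integral_eq_integral) auto
  also have "\<dots> = ennreal (sqrt (pi / c))"
    using s by simp
  finally show ?thesis .
qed

lemma nn_integral_power_exp:
  assumes "s > 0" "d > 0"
  shows "(\<integral>\<^sup>+t. ennreal (indicator {0<..} t * t powr (s - 1) * exp (- t * d)) \<partial>lborel) =
    ennreal (Gamma s / d powr s)"
proof -
  define f where "f t = ennreal (indicator {0..} t * t powr (s - 1) / exp t)" for t :: real
  have "ennreal (Gamma s) = (\<integral>\<^sup>+t. f t \<partial>lborel)"
    unfolding f_def by (rule Gamma_conv_nn_integral_real[OF assms(1)])
  \<comment> \<open>Substitution of \<open>d * t\<close> for \<open>t\<close> in Euler's integral.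
    Passing from the closed to the open half-line is harmless pointwise, because
    \<open>0 powr x\<close> is 0.\<close>
  also have "\<dots> = ennreal \<bar>d\<bar> * (\<integral>\<^sup>+t. f (0 + d * t) \<partial>lborel)"
    using assms by (intro nn_integral_real_affine) (auto simp: f_def)
  also have "(\<integral>\<^sup>+t. f (0 + d * t) \<partial>lborel) = (\<integral>\<^sup>+t. ennreal (d powr (s - 1)) *
      ennreal (indicator {0<..} t * t powr (s - 1) * exp (- t * d)) \<partial>lborel)"
  proof (rule nn_integral_cong)
    fix t :: real
    consider "t < 0" | "t = 0" | "t > 0" by linarith
    then show "f (0 + d * t) = ennreal (d powr (s - 1)) *
      ennreal (indicator {0<..} t * t powr (s - 1) * exp (- t * d))"
      using assms
      by cases (auto simp: f_def indicator_def powr_mult exp_minus field_simps zero_le_mult_iff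
          ennreal_mult[symmetric])
  qed
  also have "\<dots> = ennreal (d powr (s - 1)) *
      (\<integral>\<^sup>+t. ennreal (indicator {0<..} t * t powr (s - 1) * exp (- t * d)) \<partial>lborel)" (is "_ = _ * ?I")
    by (rule nn_integral_cmult) measurable
  finally have "ennreal (Gamma s) = ennreal (d powr s) * ?I"
    using assms by (simp add: mult.assoc[symmetric] ennreal_mult[symmetric] powr_mult_base)
  then have "ennreal (1 / d powr s) * ennreal (Gamma s) = ennreal (1 / d powr s) * ennreal (d powr s) * ?I"
    by (simp add: mult.assoc)
  then show ?thesis
    using assms by (simp add: ennreal_mult[symmetric] Gamma_real_pos less_imp_le)
qed

lemma product_sigma_finite_lborel: "product_sigma_finite (\<lambda>_. lborel :: real measure)"
  by standard

lemma borel_measurable_quad [measurable]: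
  assumes "\<And>i. i < d \<Longrightarrow> (\<lambda>x. v x i) \<in> borel_measurable N"
  shows "(\<lambda>x. quad d M (v x)) \<in> borel_measurable N"
  unfolding quad_def using assms by measurable

lemma borel_measurable_case_nat_PiM [measurable]:
  assumes "i < Suc m"
  shows "(\<lambda>x. case_nat 1 x i) \<in> borel_measurable (\<Pi>\<^sub>M i\<in>{..<m}. (lborel :: real measure))"
  using assms by (cases i) auto

text \<open>Index 0 of the form carries the homogenizing coordinate 1, so that integrating out the
  variables one by one, from the last, is elimination of the last index.\<close>

lemma nn_integral_gaussian_affine:
  assumes "pos_def (Suc m) M"
  obtains c d where "c > 0" "d > 0" "det (mat (Suc m) (Suc m) (\<lambda>(i, j). M i j)) = c * d"
    "\<And>t. t > 0 \<Longrightarrow> (\<integral>\<^sup>+x. ennreal (exp (- t * quad (Suc m) M (case_nat 1 x))) \<partial>(\<Pi>\<^sub>M i\<in>{..<m}. lborel)) =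
        ennreal (sqrt (pi / t) ^ m / sqrt c * exp (- t * d))"
  using assms
proof (induction m arbitrary: M thesis)
  case 0
  have "M 0 0 > 0"
    using pos_def_pivot[OF "0.prems"(2)] .
  then show ?case
    by (intro "0.prems"(1)[of 1 "M 0 0"]) (auto simp: det_single quad_def nn_integral_const PiM_empty)
next
  case (Suc m)
  interpret product_sigma_finite "\<lambda>_::nat. lborel :: real measure"
    by (rule product_sigma_finite_lborel)
  note pd = \<open>pos_def (Suc (Suc m)) M\<close>
  let ?S = "schur (Suc m) M" and ?\<alpha> = "M (Suc m) (Suc m)"
  have \<alpha>: "?\<alpha> > 0"
    by (rule pos_def_pivot[OF pd])
  obtain c d where cd: "c > 0" "d > 0" "det (mat (Suc m) (Suc m) (\<lambda>(i, j). ?S i j)) = c * d"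
    "\<And>t. t > 0 \<Longrightarrow> (\<integral>\<^sup>+x. ennreal (exp (- t * quad (Suc m) ?S (case_nat 1 x))) \<partial>(\<Pi>\<^sub>M i\<in>{..<m}. lborel)) =
        ennreal (sqrt (pi / t) ^ m / sqrt c * exp (- t * d))"
    using Suc.IH[OF _ pos_def_schur[OF pd]] by blast
  show ?case
  \<comment> \<open>The factor \<open>c\<close> collects the pivots of the variables already
    integrated, while \<open>d\<close> is the one pivot left at the end, the minimum of the form on
    the chart; elimination of a variable does not change it.\<close>
  proof (rule Suc.prems(1)[of "?\<alpha> * c" d])
    show "det (mat (Suc (Suc m)) (Suc (Suc m)) (\<lambda>(i, j). M i j)) = ?\<alpha> * c * d"
      using det_Suc_eq_schur[of M "Suc m"] \<alpha> cd by simp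
    fix t :: real assume t: "t > 0"
    \<comment> \<open>The shift from completing the square in the last variable. Like the Schur form
      it reads only coordinates of \<open>x\<close> below \<open>m\<close>, so it is constant in
      \<open>y\<close>.\<close>
    define h where "h x = (\<Sum>i<Suc m. M i (Suc m) * case_nat 1 x i) / ?\<alpha>" for x :: "nat \<Rightarrow> real"
    have q: "quad (Suc (Suc m)) M (case_nat 1 (x(m := y))) =
        quad (Suc m) ?S (case_nat 1 x) + ?\<alpha> * (y + h x)\<^sup>2" for x y
    proof -
      have "quad (Suc m) ?S (case_nat 1 (x(m := y))) = quad (Suc m) ?S (case_nat 1 x)"
        by (rule quad_cong) (auto split: nat.split)
      moreover have "(\<Sum>i<Suc m. M i (Suc m) * case_nat 1 (x(m := y)) i) =
          (\<Sum>i<Suc m. M i (Suc m) * case_nat 1 x i)"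
        by (rule sum.cong) (auto split: nat.split)
      ultimately show ?thesis
        using pd \<alpha> by (subst quad_Suc_eq_schur) (auto simp: pos_def_def h_def)
    qed
    have inner: "(\<integral>\<^sup>+y. ennreal (exp (- t * quad (Suc (Suc m)) M (case_nat 1 (x(m := y))))) \<partial>lborel) =
        ennreal (sqrt (pi / (t * ?\<alpha>))) * ennreal (exp (- t * quad (Suc m) ?S (case_nat 1 x)))" for x
    proof -
      have "(\<integral>\<^sup>+y. ennreal (exp (- t * quad (Suc (Suc m)) M (case_nat 1 (x(m := y))))) \<partial>lborel) =
        (\<integral>\<^sup>+y. ennreal (exp (- t * quad (Suc m) ?S (case_nat 1 x))) *
          ennreal (exp (- ((t * ?\<alpha>) * (y + h x)\<^sup>2))) \<partial>lborel)"
        by (intro nn_integral_cong) (simp add: q ennreal_mult[symmetric] exp_add[symmetric] algebra_simps)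
      also have "\<dots> = ennreal (exp (- t * quad (Suc m) ?S (case_nat 1 x))) *
          (\<integral>\<^sup>+y. ennreal (exp (- ((t * ?\<alpha>) * (y + h x)\<^sup>2))) \<partial>lborel)"
        by (rule nn_integral_cmult) measurable
      also have "(\<integral>\<^sup>+y. ennreal (exp (- ((t * ?\<alpha>) * (y + h x)\<^sup>2))) \<partial>lborel) =
          ennreal (sqrt (pi / (t * ?\<alpha>)))"
        by (rule nn_integral_gaussian) (use t \<alpha> in simp)
      finally show ?thesis
        by (simp add: mult.commute)
    qed
    have "(\<integral>\<^sup>+x. ennreal (exp (- t * quad (Suc (Suc m)) M (case_nat 1 x))) \<partial>(\<Pi>\<^sub>M i\<in>{..<Suc m}. lborel)) =
      (\<integral>\<^sup>+x. \<integral>\<^sup>+y. ennreal (exp (- t * quad (Suc (Suc m)) M (case_nat 1 (x(m := y))))) \<partial>lborel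
          \<partial>(\<Pi>\<^sub>M i\<in>{..<m}. lborel))"
      unfolding lessThan_Suc
      by (rule product_nn_integral_insert) (auto simp flip: lessThan_Suc)
    also have "\<dots> = ennreal (sqrt (pi / (t * ?\<alpha>))) *
        (\<integral>\<^sup>+x. ennreal (exp (- t * quad (Suc m) ?S (case_nat 1 x))) \<partial>(\<Pi>\<^sub>M i\<in>{..<m}. lborel))"
      unfolding inner by (rule nn_integral_cmult) measurable
    also have "\<dots> = ennreal (sqrt (pi / (t * ?\<alpha>)) * (sqrt (pi / t) ^ m / sqrt c * exp (- t * d)))"
      unfolding cd(4)[OF t] using t cd(1) \<alpha> by (intro ennreal_mult[symmetric]) auto
    also have "sqrt (pi / (t * ?\<alpha>)) * (sqrt (pi / t) ^ m / sqrt c * exp (- t * d)) =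
        sqrt (pi / t) ^ Suc m / sqrt (?\<alpha> * c) * exp (- t * d)"
      by (simp add: real_sqrt_divide real_sqrt_mult)
    finally show "(\<integral>\<^sup>+x. ennreal (exp (- t * quad (Suc (Suc m)) M (case_nat 1 x)))
        \<partial>(\<Pi>\<^sub>M i\<in>{..<Suc m}. lborel)) =
      ennreal (sqrt (pi / t) ^ Suc m / sqrt (?\<alpha> * c) * exp (- t * d))" .
  qed (use \<alpha> cd in auto)
qed

text \<open>The integral of \<open>exp (- quad)\<close> over real \<open>(m + 1)\<close>-space in
  the coordinates \<open>y = sqrt t (1, x)\<close>: their Jacobian is half of
  \<open>t powr ((m - 1) / 2)\<close>, and the half is made up by the opposite half-space, where the
  form takes the same values.\<close>

definition cone_integral :: "nat \<Rightarrow> (nat \<Rightarrow> nat \<Rightarrow> real) \<Rightarrow> ennreal" where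
  "cone_integral m M = (\<integral>\<^sup>+t. ennreal (indicator {0<..} t * t powr ((real m - 1) / 2)) *
     (\<integral>\<^sup>+x. ennreal (exp (- t * quad (Suc m) M (case_nat 1 x))) \<partial>(\<Pi>\<^sub>M i\<in>{..<m}. lborel)) \<partial>lborel)"

text \<open>The affine Gaussian integral contributes \<open>t powr (- m / 2)\<close>, which leaves
  \<open>t powr (- 1 / 2)\<close>, and the scale integral then supplies the last factor
  \<open>sqrt pi\<close> as the value of Gamma at one half.\<close>

lemma cone_integral_eq:
  assumes "pos_def (Suc m) M"
  shows "det (mat (Suc m) (Suc m) (\<lambda>(i, j). M i j)) > 0"
    and "cone_integral m M =
      ennreal (sqrt pi ^ Suc m / sqrt (det (mat (Suc m) (Suc m) (\<lambda>(i, j). M i j))))"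
proof -
  obtain c d where cd: "c > 0" "d > 0" "det (mat (Suc m) (Suc m) (\<lambda>(i, j). M i j)) = c * d"
    "\<And>t. t > 0 \<Longrightarrow> (\<integral>\<^sup>+x. ennreal (exp (- t * quad (Suc m) M (case_nat 1 x))) \<partial>(\<Pi>\<^sub>M i\<in>{..<m}. lborel)) =
        ennreal (sqrt (pi / t) ^ m / sqrt c * exp (- t * d))"
    using nn_integral_gaussian_affine[OF assms] by blast
  show "det (mat (Suc m) (Suc m) (\<lambda>(i, j). M i j)) > 0"
    using cd by simp
  have "cone_integral m M = (\<integral>\<^sup>+t. ennreal (sqrt pi ^ m / sqrt c) *
      ennreal (indicator {0<..} t * t powr (1 / 2 - 1) * exp (- t * d)) \<partial>lborel)"
    unfolding cone_integral_def
  proof (intro nn_integral_cong)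
    fix t :: real
    show "ennreal (indicator {0<..} t * t powr ((real m - 1) / 2)) *
        (\<integral>\<^sup>+x. ennreal (exp (- t * quad (Suc m) M (case_nat 1 x))) \<partial>(\<Pi>\<^sub>M i\<in>{..<m}. lborel)) =
      ennreal (sqrt pi ^ m / sqrt c) * ennreal (indicator {0<..} t * t powr (1 / 2 - 1) * exp (- t * d))"
    proof (cases "t > 0")
      case True
      have "t powr ((real m - 1) / 2) = t powr (1 / 2 - 1) * (t powr (1 / 2)) ^ m"
        using True by (simp add: powr_power powr_add[symmetric] field_simps)
      then have "t powr ((real m - 1) / 2) * sqrt (pi / t) ^ m = sqrt pi ^ m * t powr (1 / 2 - 1)"
        using True by (simp add: powr_half_sqrt real_sqrt_divide power_divide)
      then have "t powr ((real m - 1) / 2) * (sqrt (pi / t) ^ m / sqrt c * exp (- t * d)) =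
          sqrt pi ^ m / sqrt c * (t powr (1 / 2 - 1) * exp (- t * d))"
        by (simp add: field_simps)
      then show ?thesis
        using True cd by (simp add: ennreal_mult[symmetric])
    qed simp
  qed
  also have "\<dots> = ennreal (sqrt pi ^ m / sqrt c) *
      (\<integral>\<^sup>+t. ennreal (indicator {0<..} t * t powr (1 / 2 - 1) * exp (- t * d)) \<partial>lborel)"
    by (rule nn_integral_cmult) measurable
  also have "\<dots> = ennreal (sqrt pi ^ m / sqrt c * (sqrt pi / sqrt d))"
    using cd by (subst nn_integral_power_exp)
      (simp_all add: Gamma_one_half_real powr_half_sqrt ennreal_mult[symmetric])
  finally show "cone_integral m M =
      ennreal (sqrt pi ^ Suc m / sqrt (det (mat (Suc m) (Suc m) (\<lambda>(i, j). M i j))))"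
    by (simp add: cd real_sqrt_mult mult.commute)
qed

text \<open>A larger form has a smaller Gaussian integral, and that integral is a fixed constant
  over the square root of the determinant.\<close>

lemma det_mono_pos_def:
  assumes P: "pos_def (Suc m) P" and M: "pos_def (Suc m) M"
    and le: "\<And>v. quad (Suc m) P v \<le> quad (Suc m) M v"
  shows "det (mat (Suc m) (Suc m) (\<lambda>(i, j). P i j)) \<le> det (mat (Suc m) (Suc m) (\<lambda>(i, j). M i j))"
    (is "?p \<le> ?m")
proof -
  have "cone_integral m M \<le> cone_integral m P"
    unfolding cone_integral_def
  proof (intro nn_integral_mono)
    fix t :: real
    show "ennreal (indicator {0<..} t * t powr ((real m - 1) / 2)) *
        (\<integral>\<^sup>+x. ennreal (exp (- t * quad (Suc m) M (case_nat 1 x))) \<partial>(\<Pi>\<^sub>M i\<in>{..<m}. lborel)) \<le>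
      ennreal (indicator {0<..} t * t powr ((real m - 1) / 2)) *
        (\<integral>\<^sup>+x. ennreal (exp (- t * quad (Suc m) P (case_nat 1 x))) \<partial>(\<Pi>\<^sub>M i\<in>{..<m}. lborel))"
      using le by (cases "t > 0") (auto intro!: mult_left_mono nn_integral_mono ennreal_leI)
  qed
  then have "sqrt pi ^ Suc m / sqrt ?m \<le> sqrt pi ^ Suc m / sqrt ?p"
    using cone_integral_eq[OF P] cone_integral_eq[OF M]
    by (subst (asm) (1 2) cone_integral_eq) (auto simp: assms ennreal_le_iff)
  then show ?thesis
    using cone_integral_eq(1)[OF P] cone_integral_eq(1)[OF M]
    by (simp add: divide_le_cancel field_simps)
qed

section \<open>Schwinger parameters\<close>

lemma nn_integral_exp_decay:
  assumes "d > 0"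
  shows "(\<integral>\<^sup>+s. ennreal (indicator {0<..} s * exp (- s * d)) \<partial>lborel) = ennreal (1 / d)"
proof -
  have "(\<integral>\<^sup>+s. ennreal (indicator {0<..} s * exp (- s * d)) \<partial>lborel) =
      (\<integral>\<^sup>+s. ennreal (indicator {0<..} s * s powr (1 - 1) * exp (- s * d)) \<partial>lborel)"
    by (intro nn_integral_cong) (auto simp: indicator_def)
  then show ?thesis
    using nn_integral_power_exp[of 1 d] assms by simp
qed

lemma sigma_finite_PiM_lborel:
  "finite I \<Longrightarrow> sigma_finite_measure (\<Pi>\<^sub>M i\<in>I. (lborel :: real measure))"
  by (rule product_sigma_finite.sigma_finite[OF product_sigma_finite_lborel])

text \<open>Feynman's parametrization; scaling each parameter by the last one, \<open>t\<close>, leaves the others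
  as affine coordinates on the simplex.\<close>

lemma feynman_parameters:
  fixes q :: "nat \<Rightarrow> real"
  assumes q: "\<And>k. k \<le> r \<Longrightarrow> q k > 0"
  shows "ennreal (1 / (\<Prod>k<Suc r. q k)) =
    (\<integral>\<^sup>+t. \<integral>\<^sup>+a. ennreal (indicator {0<..} t * t ^ r * (\<Prod>k<r. indicator {0<..} (a k)) *
       exp (- t * ((\<Sum>k<r. a k * q k) + q r))) \<partial>(\<Pi>\<^sub>M k\<in>{..<r}. lborel) \<partial>lborel)"
proof -
  interpret product_sigma_finite "\<lambda>_::nat. lborel :: real measure"
    by (rule product_sigma_finite_lborel)
  have prod_pos: "(\<Prod>k<r. q k) > 0"
    using q by (intro prod_pos) auto
  \<comment> \<open>For fixed \<open>t > 0\<close> the integrand factors over the parameters. Each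
    of the \<open>r\<close> integrals gives \<open>1 / (t * q k)\<close>, and the powers of
    \<open>t\<close> cancel against \<open>t ^ r\<close>.\<close>
  have inner: "(\<integral>\<^sup>+a. ennreal (indicator {0<..} t * t ^ r * (\<Prod>k<r. indicator {0<..} (a k)) *
       exp (- t * ((\<Sum>k<r. a k * q k) + q r))) \<partial>(\<Pi>\<^sub>M k\<in>{..<r}. lborel)) =
     ennreal (1 / (\<Prod>k<r. q k)) * ennreal (indicator {0<..} t * exp (- t * q r))" for t
  proof (cases "t > 0")
    case True
    have "exp (- t * ((\<Sum>k<r. a k * q k) + q r)) = exp (- t * q r) * (\<Prod>k<r. exp (- a k * (t * q k)))" for a
      by (simp add: exp_sum[symmetric] exp_add[symmetric] sum_negf sum_distrib_left algebra_simps)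
    then have eq: "indicator {0<..} t * t ^ r * (\<Prod>k<r. indicator {0<..} (a k)) * exp (- t * ((\<Sum>k<r. a k * q k) + q r)) =
        t ^ r * exp (- t * q r) * (\<Prod>k<r. indicator {0<..} (a k) * exp (- a k * (t * q k)))" for a
      using True by (simp add: prod.distrib)
    have "(\<integral>\<^sup>+a. ennreal (indicator {0<..} t * t ^ r * (\<Prod>k<r. indicator {0<..} (a k)) *
         exp (- t * ((\<Sum>k<r. a k * q k) + q r))) \<partial>(\<Pi>\<^sub>M k\<in>{..<r}. lborel)) =
       (\<integral>\<^sup>+a. ennreal (t ^ r * exp (- t * q r)) *
          (\<Prod>k<r. ennreal (indicator {0<..} (a k) * exp (- a k * (t * q k)))) \<partial>(\<Pi>\<^sub>M k\<in>{..<r}. lborel))"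
    proof (rule nn_integral_cong)
      fix a :: "nat \<Rightarrow> real"
      have "(\<Prod>k<r. ennreal (indicator {0<..} (a k) * exp (- a k * (t * q k)))) =
          ennreal (\<Prod>k<r. indicator {0<..} (a k) * exp (- a k * (t * q k)))"
        by (rule prod_ennreal) simp
      then show "ennreal (indicator {0<..} t * t ^ r * (\<Prod>k<r. indicator {0<..} (a k)) *
           exp (- t * ((\<Sum>k<r. a k * q k) + q r))) =
         ennreal (t ^ r * exp (- t * q r)) * (\<Prod>k<r. ennreal (indicator {0<..} (a k) * exp (- a k * (t * q k))))"
        unfolding eq using True by (simp only:) (rule ennreal_mult, auto intro: prod_nonneg)
    qed
    also have "\<dots> = ennreal (t ^ r * exp (- t * q r)) *
        (\<integral>\<^sup>+a. (\<Prod>k<r. ennreal (indicator {0<..} (a k) * exp (- a k * (t * q k)))) \<partial>(\<Pi>\<^sub>M k\<in>{..<r}. lborel))"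
      by (rule nn_integral_cmult) measurable
    also have "(\<integral>\<^sup>+a. (\<Prod>k<r. ennreal (indicator {0<..} (a k) * exp (- a k * (t * q k)))) \<partial>(\<Pi>\<^sub>M k\<in>{..<r}. lborel)) =
        (\<Prod>k<r. \<integral>\<^sup>+s. ennreal (indicator {0<..} s * exp (- s * (t * q k))) \<partial>lborel)"
      by (rule product_nn_integral_prod) auto
    also have "\<dots> = (\<Prod>k<r. ennreal (1 / (t * q k)))"
      using True q by (intro prod.cong refl nn_integral_exp_decay) auto
    also have "\<dots> = ennreal (\<Prod>k<r. 1 / (t * q k))"
      using True q by (intro prod_ennreal) (auto intro: less_imp_le)
    also have "(\<Prod>k<r. 1 / (t * q k)) = 1 / (t ^ r * (\<Prod>k<r. q k))"
      by (simp add: prod_dividef prod.distrib)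
    also have "ennreal (t ^ r * exp (- t * q r)) * ennreal (1 / (t ^ r * (\<Prod>k<r. q k))) =
        ennreal (1 / (\<Prod>k<r. q k)) * ennreal (exp (- t * q r))"
      using True prod_pos by (simp add: ennreal_mult[symmetric])
    finally show ?thesis
      using True by simp
  qed simp
  have "(\<integral>\<^sup>+t. \<integral>\<^sup>+a. ennreal (indicator {0<..} t * t ^ r * (\<Prod>k<r. indicator {0<..} (a k)) *
       exp (- t * ((\<Sum>k<r. a k * q k) + q r))) \<partial>(\<Pi>\<^sub>M k\<in>{..<r}. lborel) \<partial>lborel) =
      ennreal (1 / (\<Prod>k<r. q k)) * (\<integral>\<^sup>+t. ennreal (indicator {0<..} t * exp (- t * q r)) \<partial>lborel)"
    unfolding inner by (rule nn_integral_cmult) measurable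
  also have "\<dots> = ennreal (1 / (\<Prod>k<Suc r. q k))"
    using q[of r] prod_pos
    by (subst nn_integral_exp_decay) (simp_all add: ennreal_mult[symmetric] less_imp_le)
  finally show ?thesis ..
qed

text \<open>Feynman's parametrization is inserted for almost every \<open>x\<close>, and three uses
  of Tonelli move the integral over \<open>x\<close> to the inside and the one over the parameters
  to the outside. This order makes the Gaussian integral in \<open>x\<close> come first.\<close>

lemma nn_integral_schwinger:
  fixes q :: "nat \<Rightarrow> 'x \<Rightarrow> real"
  assumes "sigma_finite_measure N"
    and q [measurable]: "\<And>k. k \<le> r \<Longrightarrow> q k \<in> borel_measurable N"
    and pos: "AE x in N. \<forall>k\<le>r. q k x > 0"
  shows "(\<integral>\<^sup>+x. ennreal (1 / (\<Prod>k<Suc r. q k x)) \<partial>N) =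
    (\<integral>\<^sup>+a. (\<Prod>k<r. indicator {0<..} (a k)) *
       (\<integral>\<^sup>+t. ennreal (indicator {0<..} t * t ^ r) *
         (\<integral>\<^sup>+x. ennreal (exp (- t * ((\<Sum>k<r. a k * q k x) + q r x))) \<partial>N) \<partial>lborel)
     \<partial>(\<Pi>\<^sub>M k\<in>{..<r}. lborel))"
proof -
  let ?P = "\<Pi>\<^sub>M k\<in>{..<r}. (lborel :: real measure)"
  interpret N: sigma_finite_measure N by fact
  interpret P: sigma_finite_measure ?P
    by (rule sigma_finite_PiM_lborel) simp
  interpret Nt: pair_sigma_finite lborel N ..
  interpret NP: pair_sigma_finite ?P N ..
  interpret tP: pair_sigma_finite ?P lborel ..
  define F where "F x t a = ennreal (indicator {0<..} t * t ^ r * (\<Prod>k<r. indicator {0<..} (a k)) *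
       exp (- t * ((\<Sum>k<r. a k * q k x) + q r x)))" for x t and a :: "nat \<Rightarrow> real"
  have F1: "(\<lambda>(t, x). \<integral>\<^sup>+a. F x t a \<partial>?P) \<in> borel_measurable (lborel \<Otimes>\<^sub>M N)"
    unfolding F_def case_prod_beta by measurable
  have F2: "(\<lambda>(a, x). F x t a) \<in> borel_measurable (?P \<Otimes>\<^sub>M N)" for t
    unfolding F_def case_prod_beta by measurable
  have F3: "(\<lambda>(a, t). \<integral>\<^sup>+x. F x t a \<partial>N) \<in> borel_measurable (?P \<Otimes>\<^sub>M lborel)"
    unfolding F_def case_prod_beta by measurable
  have "(\<integral>\<^sup>+x. ennreal (1 / (\<Prod>k<Suc r. q k x)) \<partial>N) = (\<integral>\<^sup>+x. \<integral>\<^sup>+t. \<integral>\<^sup>+a. F x t a \<partial>?P \<partial>lborel \<partial>N)"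
    unfolding F_def using pos
    by (intro nn_integral_cong_AE) (elim eventually_mono, rule feynman_parameters, blast)
  also have "\<dots> = (\<integral>\<^sup>+t. \<integral>\<^sup>+x. \<integral>\<^sup>+a. F x t a \<partial>?P \<partial>N \<partial>lborel)"
    by (rule Nt.Fubini'[OF F1])
  also have "\<dots> = (\<integral>\<^sup>+t. \<integral>\<^sup>+a. \<integral>\<^sup>+x. F x t a \<partial>N \<partial>?P \<partial>lborel)"
    by (intro nn_integral_cong NP.Fubini'[OF F2])
  also have "\<dots> = (\<integral>\<^sup>+a. \<integral>\<^sup>+t. \<integral>\<^sup>+x. F x t a \<partial>N \<partial>lborel \<partial>?P)"
    by (rule tP.Fubini'[OF F3])
  also have "\<dots> = (\<integral>\<^sup>+a. (\<Prod>k<r. indicator {0<..} (a k)) *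
       (\<integral>\<^sup>+t. ennreal (indicator {0<..} t * t ^ r) *
         (\<integral>\<^sup>+x. ennreal (exp (- t * ((\<Sum>k<r. a k * q k x) + q r x))) \<partial>N) \<partial>lborel) \<partial>?P)"
  proof (rule nn_integral_cong)
    fix a :: "nat \<Rightarrow> real"
    have ind: "(\<Prod>k<r. indicator {0<..} (a k)) = ennreal (\<Prod>k<r. indicator {0<..} (a k))"
      by (subst prod_ennreal[symmetric]) (simp_all add: ennreal_indicator)
    have "F x t a = (\<Prod>k<r. indicator {0<..} (a k)) * (ennreal (indicator {0<..} t * t ^ r) *
        ennreal (exp (- t * ((\<Sum>k<r. a k * q k x) + q r x))))" for x t
      unfolding ind F_def
      by (cases "t > 0") (simp_all add: ennreal_mult[symmetric] prod_nonneg ac_simps)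
    then have "(\<integral>\<^sup>+t. \<integral>\<^sup>+x. F x t a \<partial>N \<partial>lborel) =
      (\<integral>\<^sup>+t. (\<Prod>k<r. indicator {0<..} (a k)) * (ennreal (indicator {0<..} t * t ^ r) *
        (\<integral>\<^sup>+x. ennreal (exp (- t * ((\<Sum>k<r. a k * q k x) + q r x))) \<partial>N)) \<partial>lborel)"
      by (simp add: nn_integral_cmult)
    also have "\<dots> = (\<Prod>k<r. indicator {0<..} (a k)) * (\<integral>\<^sup>+t. ennreal (indicator {0<..} t * t ^ r) *
        (\<integral>\<^sup>+x. ennreal (exp (- t * ((\<Sum>k<r. a k * q k x) + q r x))) \<partial>N) \<partial>lborel)"
      by (rule nn_integral_cmult) measurable
    finally show "(\<integral>\<^sup>+t. \<integral>\<^sup>+x. F x t a \<partial>N \<partial>lborel) =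
      (\<Prod>k<r. indicator {0<..} (a k)) * (\<integral>\<^sup>+t. ennreal (indicator {0<..} t * t ^ r) *
        (\<integral>\<^sup>+x. ennreal (exp (- t * ((\<Sum>k<r. a k * q k x) + q r x))) \<partial>N) \<partial>lborel)" .
  qed
  finally show ?thesis .
qed

text \<open>Once the other coordinates are fixed, a single value of coordinate \<open>i\<close>
  makes the sum vanish, and a point is null; Tonelli assembles these fibres.\<close>

lemma AE_PiM_lborel_linear_nonzero:
  assumes "finite I" "i \<in> I" "c i \<noteq> 0"
  shows "AE x in (\<Pi>\<^sub>M k\<in>I. lborel). (\<Sum>k\<in>I. c k * x k) \<noteq> (0 :: real)"
proof -
  interpret product_sigma_finite "\<lambda>_. lborel :: real measure"
    by (rule product_sigma_finite_lborel)
  define J where "J = I - {i}"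
  have I: "I = insert i J" "finite J" "i \<notin> J"
    using assms by (auto simp: J_def)
  have inner: "(\<integral>\<^sup>+y. indicator {0} (\<Sum>k\<in>I. c k * (x(i := y)) k) \<partial>lborel) = (0 :: ennreal)" for x
  proof -
    have "(\<Sum>k\<in>I. c k * (x(i := y)) k) = c i * y + (\<Sum>k\<in>J. c k * x k)" for y
      using I by (auto intro!: sum.cong)
    then have "(\<integral>\<^sup>+y. indicator {0} (\<Sum>k\<in>I. c k * (x(i := y)) k) \<partial>lborel) =
        (\<integral>\<^sup>+y. indicator {- (\<Sum>k\<in>J. c k * x k) / c i} y \<partial>lborel)"
      using assms(3)
      by (intro nn_integral_cong) (auto simp del: fun_upd_apply simp: indicator_def field_simps add_eq_0_iff)
    also have "\<dots> = (0 :: ennreal)"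
      by simp
    finally show ?thesis .
  qed
  have "(\<integral>\<^sup>+x. indicator {0} (\<Sum>k\<in>I. c k * x k) \<partial>(\<Pi>\<^sub>M k\<in>insert i J. lborel)) =
      (\<integral>\<^sup>+x. \<integral>\<^sup>+y. indicator {0} (\<Sum>k\<in>I. c k * (x(i := y)) k) \<partial>lborel \<partial>(\<Pi>\<^sub>M k\<in>J. lborel))"
  proof (rule product_nn_integral_insert)
    show "(\<lambda>x. indicator {0} (\<Sum>k\<in>I. c k * x k)) \<in> borel_measurable (\<Pi>\<^sub>M k\<in>insert i J. lborel)"
      unfolding I(1)[symmetric] by measurable
  qed (use I in auto)
  also have "\<dots> = 0"
    unfolding inner by simp
  finally have zero: "(\<integral>\<^sup>+x. indicator {0} (\<Sum>k\<in>I. c k * x k) \<partial>(\<Pi>\<^sub>M k\<in>I. lborel)) = 0"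
    by (simp only: I(1))
  have "AE x in (\<Pi>\<^sub>M k\<in>I. lborel). indicator {0} (\<Sum>k\<in>I. c k * x k) = (0 :: ennreal)"
    by (rule nn_integral_0_iff_AE[THEN iffD1, OF _ zero]) measurable
  then show ?thesis
    by eventually_elim (auto simp: indicator_def split: if_splits)
qed

text \<open>With \<open>u = ln s\<close> this is the integral of
  \<open>exp (- \<epsilon> * \<bar>u\<bar>)\<close> over the line. Splitting at \<open>s = 1\<close>
  leaves one power of \<open>s\<close> near 0 and one near infinity, both integrable.\<close>

lemma nn_integral_log_decay:
  fixes \<epsilon> :: real
  assumes "\<epsilon> > 0"
  shows "(\<integral>\<^sup>+s. ennreal (indicator {0<..} s * (exp (- \<epsilon> * \<bar>ln s\<bar>) / s)) \<partial>lborel) < \<infinity>"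
proof -
  have 1: "(\<integral>\<^sup>+s. ennreal (s powr (\<epsilon> - 1)) * indicator {0..1} s \<partial>lborel) = ennreal (1 powr (\<epsilon> - 1 + 1) / (\<epsilon> - 1 + 1))"
    by (intro nn_integral_has_integral_lebesgue' has_integral_powr_from_0) (use assms in auto)
  have 2: "(\<integral>\<^sup>+s. ennreal (s powr (- \<epsilon> - 1)) * indicator {1..} s \<partial>lborel) = ennreal (1 / \<epsilon>)"
    by (intro nn_integral_has_integral_lebesgue')
      (use assms has_integral_powr_to_inf[of "- \<epsilon> - 1" 1] in auto)
  have "(\<integral>\<^sup>+s. ennreal (indicator {0<..} s * (exp (- \<epsilon> * \<bar>ln s\<bar>) / s)) \<partial>lborel) \<le>
      (\<integral>\<^sup>+s. ennreal (s powr (\<epsilon> - 1)) * indicator {0..1} s + ennreal (s powr (- \<epsilon> - 1)) * indicator {1..} s \<partial>lborel)"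
  proof (rule nn_integral_mono)
    fix s :: real
    consider "s \<le> 0" | "0 < s" "s \<le> 1" | "1 < s" by linarith
    then show "ennreal (indicator {0<..} s * (exp (- \<epsilon> * \<bar>ln s\<bar>) / s)) \<le>
      ennreal (s powr (\<epsilon> - 1)) * indicator {0..1} s + ennreal (s powr (- \<epsilon> - 1)) * indicator {1..} s"
      by cases (auto simp: indicator_def powr_def left_diff_distrib exp_diff)
  qed
  also have "\<dots> = (\<integral>\<^sup>+s. ennreal (s powr (\<epsilon> - 1)) * indicator {0..1} s \<partial>lborel) +
      (\<integral>\<^sup>+s. ennreal (s powr (- \<epsilon> - 1)) * indicator {1..} s \<partial>lborel)"
    by (rule nn_integral_add) auto
  also have "\<dots> < \<infinity>"
    unfolding 1 2 by simp
  finally show ?thesis .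
qed

section \<open>Spanning sets of edge functionals\<close>

interpretation frag: Modules.module "frag_cmul :: int \<Rightarrow> ('a \<Rightarrow>\<^sub>0 int) \<Rightarrow> _"
  by unfold_locales (simp_all add: frag_cmul_distrib frag_cmul_distrib2)

text \<open>Fewer homogeneous equations than unknowns. The criterion that a singular matrix has a
  kernel vector holds over integral domains, so the solution is integral.\<close>

lemma integer_relation:
  fixes f :: "nat \<Rightarrow> nat \<Rightarrow> int"
  assumes "r < s"
  obtains z j where "j < s" "z j \<noteq> 0" "\<And>i. i < r \<Longrightarrow> (\<Sum>j<s. z j * f i j) = 0"
proof -
  \<comment> \<open>Zero rows make the system square; row \<open>r\<close> is one of them, so every
    term of the Leibniz expansion vanishes.\<close>
  define A where "A = mat s s (\<lambda>(i, j). if i < r then f i j else 0)"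
  have A: "A \<in> carrier_mat s s"
    by (simp add: A_def)
  have "(\<Prod>i = 0..<s. A $$ (i, p i)) = 0" if "p permutes {0..<s}" for p
    using assms permutes_in_image[OF that, of r] by (intro prod_zero) (auto simp: A_def intro!: bexI[of _ r])
  then have "det A = 0"
    unfolding det_def'[OF A] by (intro sum.neutral) auto
  then obtain v where v: "v \<in> carrier_vec s" "v \<noteq> 0\<^sub>v s" "A *\<^sub>v v = 0\<^sub>v s"
    using det_0_iff_vec_prod_zero[OF A] by blast
  then obtain j where j: "j < s" "v $ j \<noteq> 0"
    by (metis carrier_vecD eq_vecI index_zero_vec)
  have "(\<Sum>j<s. v $ j * f i j) = 0" if "i < r" for i
  proof -
    have "(A *\<^sub>v v) $ i = (\<Sum>j<s. v $ j * f i j)"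
      using that assms v(1)
      by (auto simp: A_def scalar_prod_def atLeast0LessThan ac_simps intro!: sum.cong)
    then show ?thesis
      using v(3) that assms by simp
  qed
  with j show ?thesis
    by (intro that[of j "\<lambda>j. v $ j"])
qed

text \<open>Dependence attaches coefficients to the elements of a set; the arguments below index
  them by edges or by positions in a basis, and injectivity translates between the two.\<close>

lemma independent_family_iff:
  assumes "finite I" "inj_on x I"
  shows "\<not> frag.dependent (x ` I) \<longleftrightarrow> (\<forall>z. (\<Sum>i\<in>I. frag_cmul (z i) (x i)) = 0 \<longrightarrow> (\<forall>i\<in>I. z i = 0))"
proof
  assume "\<not> frag.dependent (x ` I)"
  then have ind: "\<And>u. (\<Sum>v\<in>x ` I. frag_cmul (u v) v) = 0 \<Longrightarrow> \<forall>v\<in>x ` I. u v = 0"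
    using frag.dependent_finite[of "x ` I"] assms(1) by auto
  show "\<forall>z. (\<Sum>i\<in>I. frag_cmul (z i) (x i)) = 0 \<longrightarrow> (\<forall>i\<in>I. z i = 0)"
  proof (intro allI impI)
    fix z assume z: "(\<Sum>i\<in>I. frag_cmul (z i) (x i)) = 0"
    have "(\<Sum>v\<in>x ` I. frag_cmul (z (the_inv_into I x v)) v) = (\<Sum>i\<in>I. frag_cmul (z i) (x i))"
      using assms by (simp add: sum.reindex the_inv_into_f_f)
    with z ind[of "\<lambda>v. z (the_inv_into I x v)"] show "\<forall>i\<in>I. z i = 0"
      using assms by (simp add: the_inv_into_f_f)
  qed
next
  assume *: "\<forall>z. (\<Sum>i\<in>I. frag_cmul (z i) (x i)) = 0 \<longrightarrow> (\<forall>i\<in>I. z i = 0)"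
  show "\<not> frag.dependent (x ` I)"
  proof
    assume "frag.dependent (x ` I)"
    then obtain u where u: "\<exists>v\<in>x ` I. u v \<noteq> 0" "(\<Sum>v\<in>x ` I. frag_cmul (u v) v) = 0"
      using frag.dependent_finite[of "x ` I"] assms(1) by auto
    then have "(\<Sum>i\<in>I. frag_cmul (u (x i)) (x i)) = 0"
      using assms by (simp add: sum.reindex)
    with *[rule_format, of "\<lambda>i. u (x i)"] have "\<forall>i\<in>I. u (x i) = 0"
      by blast
    with u(1) show False
      by auto
  qed
qed

lemma independent_familyD:
  assumes "finite I" "inj_on x I" "\<not> frag.dependent (x ` I)"
    and "(\<Sum>i\<in>I. frag_cmul (z i) (x i)) = 0" "i \<in> I"
  shows "z i = 0"
  using independent_family_iff[OF assms(1,2)] assms(3-5) by metis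

text \<open>Cycles are determined by their coefficients on \<open>S\<close>, so more than
  \<open>card S\<close> of them satisfy an integer relation. The bound makes the set in
  \<open>betti1\<close> finite and its \<open>Max\<close> meaningful.\<close>

lemma card_independent_cycles_le:
  assumes "finite S" "finite B" "B \<subseteq> H1 G S" "\<not> frag.dependent B"
  shows "card B \<le> card S"
proof (rule ccontr)
  assume "\<not> card B \<le> card S"
  then have less: "card S < card B" by simp
  obtain s x where s: "bij_betw s {..<card S} S" and x: "bij_betw x {..<card B} B"
    using ex_bij_betw_nat_finite assms(1,2) by (metis atLeast0LessThan)
  obtain z j where z: "j < card B" "z j \<noteq> 0"
    "\<And>i. i < card S \<Longrightarrow> (\<Sum>j<card B. z j * Poly_Mapping.lookup (x j) (s i)) = 0"
    using integer_relation[OF less, of "\<lambda>i j. Poly_Mapping.lookup (x j) (s i)"] by metis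
  have "(\<Sum>j<card B. frag_cmul (z j) (x j)) = 0"
  proof (rule poly_mapping_eqI)
    fix a
    show "Poly_Mapping.lookup (\<Sum>j<card B. frag_cmul (z j) (x j)) a = Poly_Mapping.lookup 0 a"
    proof (cases "a \<in> S")
      case True
      then obtain i where "i < card S" "a = s i"
        using s by (auto simp: bij_betw_def)
      then show ?thesis
        using z(3) by (simp add: lookup_sum)
    next
      case False
      have "Poly_Mapping.lookup (x j) a = 0" if "j < card B" for j
      proof -
        have "x j \<in> H1 G S"
          using that x assms(3) by (auto simp: bij_betw_def)
        with False show ?thesis
          by (auto simp: H1_def in_keys_iff)
      qed
      then show ?thesis
        by (simp add: lookup_sum)
    qed
  qed
  moreover have "\<not> frag.dependent (x ` {..<card B})" "inj_on x {..<card B}"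
    using x assms(4) by (auto simp: bij_betw_def)
  ultimately show False
    using z independent_familyD[of "{..<card B}" x z j] by simp
qed

lemma card_le_betti1:
  assumes "finite S" "finite B" "B \<subseteq> H1 G S" "\<not> frag.dependent B"
  shows "card B \<le> betti1 G S"
  unfolding betti1_def
proof (rule Max_ge)
  show "finite {card B |B. finite B \<and> B \<subseteq> H1 G S \<and> \<not> frag.dependent B}"
    by (rule finite_subset[of _ "{..card S}"]) (use card_independent_cycles_le[OF assms(1)] in auto)
qed (use assms in auto)

lemma boundary_sum:
  "boundary G (\<Sum>j\<in>I. frag_cmul (z j) (x j)) = (\<Sum>j\<in>I. frag_cmul (z j) (boundary G (x j)))"
  by (induction I rule: infinite_finite_induct)
    (simp_all add: boundary_def frag_extend_add frag_extend_cmul)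

lemma H1_sum:
  assumes "\<And>j. j \<in> I \<Longrightarrow> x j \<in> H1 G S"
  shows "(\<Sum>j\<in>I. frag_cmul (z j) (x j)) \<in> H1 G S"
proof -
  have "Poly_Mapping.lookup (\<Sum>j\<in>I. frag_cmul (z j) (x j)) a = 0" if "a \<notin> S" for a
  proof -
    have "Poly_Mapping.lookup (x j) a = 0" if "j \<in> I" for j
      using assms[OF that] \<open>a \<notin> S\<close> by (auto simp: H1_def in_keys_iff)
    then show ?thesis
      by (simp add: lookup_sum)
  qed
  moreover have "boundary G (\<Sum>j\<in>I. frag_cmul (z j) (x j)) = 0"
    using assms by (auto simp: boundary_sum H1_def intro!: sum.neutral)
  ultimately show ?thesis
    by (auto simp: H1_def in_keys_iff)
qed

text \<open>Echelon form: in a relation read at the edge \<open>e i\<close>, members with larger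
  index vanish by assumption and coefficients of smaller index vanish by induction, so only the
  diagonal term is left.\<close>

lemma triangular_independent:
  fixes e :: "nat \<Rightarrow> 'e"
  assumes "finite I"
    and below: "\<And>k j. k \<in> I \<Longrightarrow> j < k \<Longrightarrow> Poly_Mapping.lookup (w k) (e j) = 0"
    and diag: "\<And>k. k \<in> I \<Longrightarrow> Poly_Mapping.lookup (w k) (e k) \<noteq> 0"
  shows "inj_on w I" "\<not> frag.dependent (w ` I)"
proof -
  show inj: "inj_on w I"
  proof (rule linorder_inj_onI)
    fix i k assume "i < k" "i \<in> I" "k \<in> I"
    then show "w i \<noteq> w k"
      using below[of k i] diag[of i] by auto
  qed auto
  have "z i = 0" if z: "(\<Sum>i\<in>I. frag_cmul (z i) (w i)) = 0" and "i \<in> I" for z i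
    using \<open>i \<in> I\<close>
  proof (induction i rule: less_induct)
    case (less i)
    have "0 = Poly_Mapping.lookup (\<Sum>i\<in>I. frag_cmul (z i) (w i)) (e i)"
      using z by simp
    also have "\<dots> = (\<Sum>k\<in>I. z k * Poly_Mapping.lookup (w k) (e i))"
      by (simp add: lookup_sum)
    also have "\<dots> = (\<Sum>k\<in>{i}. z k * Poly_Mapping.lookup (w k) (e i))"
    proof (rule sum.mono_neutral_right)
      show "\<forall>k\<in>I - {i}. z k * Poly_Mapping.lookup (w k) (e i) = 0"
      proof
        fix k assume k: "k \<in> I - {i}"
        then consider "k < i" | "i < k"
          by (metis DiffE insertI1 linorder_neqE_nat)
        then show "z k * Poly_Mapping.lookup (w k) (e i) = 0"
          using k less.IH[of k] below[of k i] by cases auto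
      qed
    qed (use assms(1) less.prems in auto)
    finally show ?case
      using diag[OF less.prems] by simp
  qed
  then show "\<not> frag.dependent (w ` I)"
    unfolding independent_family_iff[OF assms(1) inj] by simp
qed

text \<open>An edge is chosen when its functional does not vanish on the cycles that avoid all
  earlier edges; for edges listed by decreasing Schwinger parameter this is the greedy basis,
  whose monomial dominates the graph polynomial.\<close>

lemma greedy_edge_basis:
  fixes G :: "('v, 'e) pre_digraph"
  assumes "betti1 G (arcs G) = n"
    and e: "bij_betw e {..<2 * n} (arcs G)"
    and b: "H1_basis G n b"
    and conv: "\<And>S. S \<noteq> {} \<Longrightarrow> S \<subset> arcs G \<Longrightarrow> convergent_subgraph G S"
  obtains \<beta> where "inj_on \<beta> {..<n}" "\<beta> ` {..<n} \<subseteq> {..<2 * n}"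
    "det (mat n n (\<lambda>(i, j). Poly_Mapping.lookup (b j) (e (\<beta> i)))) \<noteq> 0"
    "\<And>m. 0 < m \<Longrightarrow> m < 2 * n \<Longrightarrow> m < 2 * card (\<beta> ` {..<n} \<inter> {..<m})"
proof -
  have arcs: "arcs G = e ` {..<2 * n}" and inj_e: "inj_on e {..<2 * n}"
    using e by (auto simp: bij_betw_def)
  define K where "K k = {x \<in> H1 G (arcs G). \<forall>j<k. Poly_Mapping.lookup x (e j) = 0}" for k
  define B where "B = {k. k < 2 * n \<and> (\<exists>x\<in>K k. Poly_Mapping.lookup x (e k) \<noteq> 0)}"
  have "\<forall>k. \<exists>x. k \<in> B \<longrightarrow> x \<in> K k \<and> Poly_Mapping.lookup x (e k) \<noteq> 0"
    by (auto simp: B_def)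
  then obtain w where w: "\<And>k. k \<in> B \<Longrightarrow> w k \<in> K k" "\<And>k. k \<in> B \<Longrightarrow> Poly_Mapping.lookup (w k) (e k) \<noteq> 0"
    by metis
  have finB: "finite B"
    by (simp add: B_def)
  \<comment> \<open>The witnesses of chosen edges from the \<open>m\<close>-th on avoid the first
    \<open>m\<close> edges and are in echelon form, so they are independent cycles of the subgraph
    of the remaining edges.\<close>
  have tail: "card (B - {..<m}) \<le> betti1 G (e ` {m..<2 * n})" for m
  proof -
    have tri: "inj_on w (B - {..<m})" "\<not> frag.dependent (w ` (B - {..<m}))"
      using triangular_independent[of "B - {..<m}" w e] w finB by (auto simp: K_def)
    have "w k \<in> H1 G (e ` {m..<2 * n})" if "k \<in> B - {..<m}" for k
    proof -
      have "w k \<in> H1 G (arcs G)" "\<forall>j<m. Poly_Mapping.lookup (w k) (e j) = 0"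
        using w(1)[of k] that by (auto simp: K_def)
      moreover have "a \<in> e ` {m..<2 * n}" if a: "Poly_Mapping.lookup (w k) a \<noteq> 0" "a \<in> arcs G" for a
      proof -
        obtain i where i: "i < 2 * n" "a = e i"
          using a(2) unfolding arcs by blast
        have "m \<le> i"
          using a(1) calculation(2) i(2) by (meson not_less)
        with i show ?thesis
          by simp
      qed
      ultimately show ?thesis
        unfolding H1_def by (auto simp: in_keys_iff subset_iff)
    qed
    then have "card (w ` (B - {..<m})) \<le> betti1 G (e ` {m..<2 * n})"
      using tri(2) finB by (intro card_le_betti1) auto
    then show ?thesis
      using card_image[OF tri(1)] by simp
  qed
  have b': "inj_on b {..<n}" "\<not> frag.dependent (b ` {..<n})" "\<And>j. j < n \<Longrightarrow> b j \<in> H1 G (arcs G)"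
    using b frag.span_superset[of "b ` {..<n}"] by (auto simp: H1_basis_def)
  \<comment> \<open>A cycle killed by all chosen functionals is zero, edge by edge in the given
    order: if the edge \<open>e k\<close> is not chosen, every cycle that avoids the earlier edges
    vanishes there too.\<close>
  have kernel: "z j = 0" if z: "\<And>k. k \<in> B \<Longrightarrow> (\<Sum>j<n. z j * Poly_Mapping.lookup (b j) (e k)) = 0" and "j < n" for z j
  proof -
    define x where "x = (\<Sum>j<n. frag_cmul (z j) (b j))"
    have x: "x \<in> H1 G (arcs G)"
      unfolding x_def by (rule H1_sum) (use b' in auto)
    have "k < 2 * n \<Longrightarrow> Poly_Mapping.lookup x (e k) = 0" for k
    proof (induction k rule: less_induct)
      case (less k)
      show ?case
      proof (cases "k \<in> B")
        case True
        with z show ?thesis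
          by (simp add: x_def lookup_sum)
      next
        case False
        with less x show ?thesis
          by (auto simp: B_def K_def)
      qed
    qed
    then have "x = 0"
      using x by (intro poly_mapping_eqI) (auto simp: H1_def in_keys_iff arcs)
    then show ?thesis
      using independent_familyD[of "{..<n}" b z j] b' \<open>j < n\<close> unfolding x_def by simp
  qed
  have "card B \<le> n"
    using tail[of 0] assms(1) by (simp add: arcs atLeast0LessThan)
  \<comment> \<open>Fewer than \<open>n\<close> chosen functionals would have a nonzero integer
    combination of the basis cycles as common zero, contrary to \<open>kernel\<close>.\<close>
  moreover have "\<not> card B < n"
  proof
    assume less: "card B < n"
    obtain \<beta> where \<beta>: "bij_betw \<beta> {..<card B} B"
      using ex_bij_betw_nat_finite[OF finB] by (auto simp: atLeast0LessThan)
    obtain z j where "j < n" "z j \<noteq> 0"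
      "\<And>i. i < card B \<Longrightarrow> (\<Sum>j<n. z j * Poly_Mapping.lookup (b j) (e (\<beta> i))) = 0"
      using integer_relation[OF less, of "\<lambda>i j. Poly_Mapping.lookup (b j) (e (\<beta> i))"] by metis
    moreover from this(3) have "\<And>k. k \<in> B \<Longrightarrow> (\<Sum>j<n. z j * Poly_Mapping.lookup (b j) (e k)) = 0"
      using \<beta> by (force simp: bij_betw_def)
    ultimately show False
      using kernel by blast
  qed
  ultimately have card: "card B = n" by simp
  then obtain \<beta> where \<beta>: "bij_betw \<beta> {..<n} B"
    using ex_bij_betw_nat_finite[OF finB] by (auto simp: atLeast0LessThan)
  show ?thesis
  proof (rule that[of \<beta>])
    show "inj_on \<beta> {..<n}" "\<beta> ` {..<n} \<subseteq> {..<2 * n}"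
      using \<beta> by (auto simp: bij_betw_def B_def)
    define L where "L = mat n n (\<lambda>(i, j). Poly_Mapping.lookup (b j) (e (\<beta> i)))"
    have L: "L \<in> carrier_mat n n"
      by (simp add: L_def)
    show "det (mat n n (\<lambda>(i, j). Poly_Mapping.lookup (b j) (e (\<beta> i)))) \<noteq> 0"
      unfolding L_def[symmetric]
    proof
      assume "det L = 0"
      then obtain v where v: "v \<in> carrier_vec n" "v \<noteq> 0\<^sub>v n" "L *\<^sub>v v = 0\<^sub>v n"
        using det_0_iff_vec_prod_zero[OF L] by blast
      have "(\<Sum>j<n. v $ j * Poly_Mapping.lookup (b j) (e (\<beta> i))) = 0" if "i < n" for i
      proof -
        have "(L *\<^sub>v v) $ i = (\<Sum>j<n. v $ j * Poly_Mapping.lookup (b j) (e (\<beta> i)))"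
          using that v(1)
          by (auto simp: L_def scalar_prod_def atLeast0LessThan ac_simps intro!: sum.cong)
        then show ?thesis
          using v(3) that by simp
      qed
      then have "v $ j = 0" if "j < n" for j
        using kernel[of "\<lambda>j. v $ j" j] that \<beta> by (auto simp: bij_betw_def)
      then show False
        using v(1,2) by (metis carrier_vecD eq_vecI index_zero_vec)
    qed
    fix m assume m: "0 < m" "m < 2 * n"
    have "e ` {m..<2 * n} \<noteq> {}" "e ` {m..<2 * n} \<subset> arcs G"
    proof -
      have "e 0 \<in> arcs G" "e 0 \<notin> e ` {m..<2 * n}"
        using m inj_onD[OF inj_e, of 0] by (force simp: arcs)+
      then show "e ` {m..<2 * n} \<subset> arcs G"
        by (auto simp: arcs)
    qed (use m in auto)
    then have "2 * betti1 G (e ` {m..<2 * n}) < card (e ` {m..<2 * n})"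
      using conv by (simp add: convergent_subgraph_def)
    also have "card (e ` {m..<2 * n}) = 2 * n - m"
    proof -
      have "inj_on e {m..<2 * n}"
        by (rule inj_on_subset[OF inj_e]) auto
      then show ?thesis
        by (simp add: card_image)
    qed
    \<comment> \<open>Convergence limits the chosen edges from the \<open>m\<close>-th on to fewer
      than half of those edges; as \<open>n\<close> of the \<open>2 * n\<close> edges are chosen,
      more than half of the first \<open>m\<close> are.\<close>
    finally have "2 * card (B - {..<m}) < 2 * n - m"
      using tail[of m] by linarith
    moreover have "card B = card (B \<inter> {..<m}) + card (B - {..<m})"
      using finB by (metis card_Int_Diff)
    ultimately show "m < 2 * card (\<beta> ` {..<n} \<inter> {..<m})"
      using \<beta> card m by (simp add: bij_betw_def)
  qed
qed

section \<open>A lower bound for the graph polynomial\<close>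

text \<open>Abel summation: with partial sums \<open>C m\<close> of \<open>c\<close>, the sum is
  that of \<open>C m * (x (m - 1) - x m)\<close> over \<open>0 < m < N\<close>, the boundary term
  dropping out because the total is 0. Each \<open>C m\<close> is at least 1 and each difference is
  nonnegative, so the bound telescopes.\<close>

lemma summation_by_parts_bound:
  fixes x c :: "nat \<Rightarrow> real"
  assumes "0 < N"
    and dec: "\<And>k. Suc k < N \<Longrightarrow> x (Suc k) \<le> x k"
    and partial: "\<And>m. 0 < m \<Longrightarrow> m < N \<Longrightarrow> 1 \<le> (\<Sum>k<m. c k)"
    and total: "(\<Sum>k<N. c k) = 0"
  shows "x 0 - x (N - 1) \<le> (\<Sum>k<N. c k * x k)"
proof -
  have "x 0 - x m + (\<Sum>k<Suc m. c k) * x m \<le> (\<Sum>k<Suc m. c k * x k)" if "m < N" for m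
    using that
  proof (induction m)
    case (Suc m)
    have "((\<Sum>k<Suc m. c k) - 1) * x (Suc m) \<le> ((\<Sum>k<Suc m. c k) - 1) * x m"
      using partial[of "Suc m"] dec[OF Suc.prems] Suc.prems
      by (intro mult_left_mono) (simp_all del: sum.lessThan_Suc)
    moreover have "x 0 - x m + (\<Sum>k<Suc m. c k) * x m \<le> (\<Sum>k<Suc m. c k * x k)"
      using Suc by simp
    ultimately show ?case
      unfolding sum.lessThan_Suc[of _ "Suc m"] distrib_right left_diff_distrib by linarith
  qed simp
  from this[of "N - 1"] show ?thesis
    using assms(1) total by (simp del: sum.lessThan_Suc)
qed

lemma decreasing_enumeration:
  fixes A :: "nat \<Rightarrow> real"
  obtains \<pi> where "bij_betw \<pi> {..<N} {..<N}" "\<And>i j. i \<le> j \<Longrightarrow> j < N \<Longrightarrow> A (\<pi> j) \<le> A (\<pi> i)"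
proof -
  define xs where "xs = sort_key (\<lambda>k. - A k) [0..<N]"
  have xs: "set xs = {..<N}" "distinct xs" "length xs = N" "sorted (map (\<lambda>k. - A k) xs)"
    by (simp_all add: xs_def atLeast0LessThan)
  show ?thesis
  proof (rule that[of "(!) xs"])
    show "bij_betw ((!) xs) {..<N} {..<N}"
      by (rule bij_betw_nth) (use xs(1-3) in auto)
    fix i j assume "i \<le> j" "j < N"
    then show "A (xs ! j) \<le> A (xs ! i)"
      using sorted_nth_mono[OF xs(4), of i j] xs(3) by auto
  qed
qed

lemma quad_edge_gram:
  "quad n (edge_gram n b e a) v = (\<Sum>k<2 * n. a k * (\<Sum>j<n. edge_coeff b (e k) j * v j)\<^sup>2)"
proof -
  have "a k * (\<Sum>j<n. edge_coeff b (e k) j * v j)\<^sup>2 =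
      (\<Sum>i<n. \<Sum>j<n. a k * (edge_coeff b (e k) i * edge_coeff b (e k) j) * v i * v j)" for k
    unfolding power2_eq_square sum_product unfolding sum_distrib_left
    by (intro sum.cong refl) simp
  then have "(\<Sum>k<2 * n. a k * (\<Sum>j<n. edge_coeff b (e k) j * v j)\<^sup>2) =
      (\<Sum>k<2 * n. \<Sum>i<n. \<Sum>j<n. a k * (edge_coeff b (e k) i * edge_coeff b (e k) j) * v i * v j)"
    by simp
  also have "\<dots> = (\<Sum>i<n. \<Sum>k<2 * n. \<Sum>j<n. a k * (edge_coeff b (e k) i * edge_coeff b (e k) j) * v i * v j)"
    by (rule sum.swap)
  also have "\<dots> = (\<Sum>i<n. \<Sum>j<n. \<Sum>k<2 * n. a k * (edge_coeff b (e k) i * edge_coeff b (e k) j) * v i * v j)"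
    by (intro sum.cong[OF refl] sum.swap)
  finally show ?thesis
    unfolding quad_def edge_gram_def sum_distrib_right by simp
qed

lemma edge_gram_sym: "edge_gram n b e a i j = edge_gram n b e a j i"
  by (simp add: edge_gram_def mult.commute)

context
  fixes n :: nat and b :: "nat \<Rightarrow> 'e \<Rightarrow>\<^sub>0 int" and e :: "nat \<Rightarrow> 'e" and \<beta> :: "nat \<Rightarrow> nat" and a :: "nat \<Rightarrow> real"
  assumes \<beta>: "inj_on \<beta> {..<n}" "\<beta> ` {..<n} \<subseteq> {..<2 * n}"
    and nonsingular: "det (mat n n (\<lambda>(i, j). Poly_Mapping.lookup (b j) (e (\<beta> i)))) \<noteq> 0"
    and pos: "\<And>k. k < 2 * n \<Longrightarrow> a k > 0"
begin

definition "basis_matrix = mat n n (\<lambda>(i, j). edge_coeff b (e (\<beta> i)) j)"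

text \<open>The determinant is a nonzero integer, which is all that is used about its value.\<close>

lemma det_basis_matrix: "1 \<le> (det basis_matrix)\<^sup>2"
proof -
  let ?L = "mat n n (\<lambda>(i, j). Poly_Mapping.lookup (b j) (e (\<beta> i)))"
  have "basis_matrix = map_mat of_int ?L"
    by (auto simp: basis_matrix_def edge_coeff_def)
  then have "det basis_matrix = of_int (det ?L)"
    by simp
  then have "(det basis_matrix)\<^sup>2 = of_int ((det ?L)\<^sup>2)"
    by simp
  moreover have "1 \<le> (det ?L)\<^sup>2"
    using nonsingular by (smt (verit) zero_less_power2)
  ultimately show ?thesis
    by linarith
qed

text \<open>The parameters with every edge outside the chosen basis switched off. This lowers the
  form and reduces the determinant to a single monomial.\<close>

definition "basis_weight k = (if k \<in> \<beta> ` {..<n} then a k else 0)"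

lemma sum_basis_weight: "(\<Sum>k<2 * n. basis_weight k * f k) = (\<Sum>i<n. a (\<beta> i) * f (\<beta> i))"
proof -
  have "(\<Sum>k<2 * n. basis_weight k * f k) = (\<Sum>k\<in>\<beta> ` {..<n}. basis_weight k * f k)"
    using \<beta> by (intro sum.mono_neutral_right) (auto simp: basis_weight_def)
  also have "\<dots> = (\<Sum>i<n. a (\<beta> i) * f (\<beta> i))"
    using \<beta> by (simp add: sum.reindex basis_weight_def)
  finally show ?thesis .
qed

lemma pos_def_basis_weight: "pos_def n (edge_gram n b e basis_weight)"
  unfolding pos_def_def
proof (intro conjI allI impI edge_gram_sym)
  fix v :: "nat \<Rightarrow> real" assume v: "\<exists>i<n. v i \<noteq> 0"
  let ?l = "\<lambda>i. \<Sum>j<n. edge_coeff b (e (\<beta> i)) j * v j"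
  have eq: "quad n (edge_gram n b e basis_weight) v = (\<Sum>i<n. a (\<beta> i) * (?l i)\<^sup>2)"
    unfolding quad_edge_gram sum_basis_weight ..
  have a: "a (\<beta> i) > 0" if "i < n" for i
    using that \<beta> pos by auto
  have "\<exists>i<n. ?l i \<noteq> 0"
  proof (rule ccontr)
    assume *: "\<not> (\<exists>i<n. ?l i \<noteq> 0)"
    have carrier: "basis_matrix \<in> carrier_mat n n"
      by (simp add: basis_matrix_def)
    have "basis_matrix *\<^sub>v vec n v = 0\<^sub>v n"
      using * by (intro eq_vecI) (auto simp: basis_matrix_def scalar_prod_def atLeast0LessThan)
    moreover have "vec n v \<noteq> 0\<^sub>v n"
      using v by (metis index_vec index_zero_vec(1))
    ultimately have "det basis_matrix = 0"
      using det_0_iff_vec_prod_zero[OF carrier] by (meson vec_carrier)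
    then show False
      using det_basis_matrix by simp
  qed
  then obtain i where "i < n" "?l i \<noteq> 0" by blast
  then have "0 < (\<Sum>i<n. a (\<beta> i) * (?l i)\<^sup>2)"
    using a by (intro sum_pos2[of _ i]) (auto intro!: mult_nonneg_nonneg less_imp_le[of 0 "a _"])
  then show "0 < quad n (edge_gram n b e basis_weight) v"
    using eq by simp
qed

lemma quad_basis_weight_le: "quad n (edge_gram n b e basis_weight) v \<le> quad n (edge_gram n b e a) v"
  unfolding quad_edge_gram using pos
  by (intro sum_mono mult_right_mono) (auto simp: basis_weight_def less_imp_le)

lemma pos_def_edge_gram_basis: "pos_def n (edge_gram n b e a)"
  unfolding pos_def_def
proof (intro conjI allI impI edge_gram_sym)
  fix v :: "nat \<Rightarrow> real" assume v: "\<exists>i<n. v i \<noteq> 0"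
  then have "0 < quad n (edge_gram n b e basis_weight) v"
    using pos_def_basis_weight by (simp add: pos_def_def)
  also note quad_basis_weight_le
  finally show "0 < quad n (edge_gram n b e a) v" .
qed

text \<open>With just \<open>n\<close> edges left, the Gram matrix is the product of three square
  matrices: the transposed basis matrix, the diagonal of the weights, and the basis matrix.\<close>

lemma det_basis_weight:
  "det (mat n n (\<lambda>(i, j). edge_gram n b e basis_weight i j)) = (det basis_matrix)\<^sup>2 * (\<Prod>i<n. a (\<beta> i))"
proof -
  define D where "D = mat n n (\<lambda>(i, j). if i = j then a (\<beta> i) else 0)"
  have L: "basis_matrix \<in> carrier_mat n n" "D \<in> carrier_mat n n"
    by (simp_all add: basis_matrix_def D_def)
  have DL: "D * basis_matrix = mat n n (\<lambda>(i, j). a (\<beta> i) * edge_coeff b (e (\<beta> i)) j)"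
    by (intro eq_matI) (auto simp: D_def basis_matrix_def scalar_prod_def if_distrib[where f = "\<lambda>x. x * _"] cong: if_cong)
  have "mat n n (\<lambda>(i, j). edge_gram n b e basis_weight i j) = transpose_mat basis_matrix * (D * basis_matrix)"
    unfolding DL edge_gram_def sum_basis_weight
    by (intro eq_matI) (auto simp: basis_matrix_def scalar_prod_def atLeast0LessThan ac_simps intro!: sum.cong)
  then have "det (mat n n (\<lambda>(i, j). edge_gram n b e basis_weight i j)) =
      det (transpose_mat basis_matrix) * (det D * det basis_matrix)"
    using L by (simp add: det_mult[of _ n])
  moreover have "det (transpose_mat basis_matrix) = det basis_matrix"
    by (rule det_transpose[OF L(1)])
  moreover have "det D = (\<Prod>i<n. a (\<beta> i))"
    by (subst det_upper_triangular[of _ n]) (auto simp: D_def prod_list_diag_prod atLeast0LessThan intro!: upper_triangularI)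
  ultimately show ?thesis
    by (simp add: power2_eq_square)
qed

text \<open>Switching off edges can only lower the determinant, by its monotonicity on positive
  definite forms, and the remaining monomial has coefficient at least 1.\<close>

lemma det_edge_gram_ge_basis:
  assumes "n > 0"
  shows "(\<Prod>i<n. a (\<beta> i)) \<le> det (mat n n (\<lambda>(i, j). edge_gram n b e a i j))"
proof -
  obtain m where m: "n = Suc m"
    using assms gr0_implies_Suc by blast
  have "(\<Prod>i<n. a (\<beta> i)) > 0"
    using \<beta> pos by (intro prod_pos) auto
  then have "(\<Prod>i<n. a (\<beta> i)) \<le> det (mat n n (\<lambda>(i, j). edge_gram n b e basis_weight i j))"
    unfolding det_basis_weight using det_basis_matrix by simp
  also have "\<dots> \<le> det (mat n n (\<lambda>(i, j). edge_gram n b e a i j))"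
    using det_mono_pos_def[OF pos_def_basis_weight[unfolded m] pos_def_edge_gram_basis[unfolded m]]
      quad_basis_weight_le
    unfolding m by simp
  finally show ?thesis .
qed

end

context
  fixes G :: "('v, 'e) pre_digraph" and n :: nat and e :: "nat \<Rightarrow> 'e" and b :: "nat \<Rightarrow> 'e \<Rightarrow>\<^sub>0 int"
  assumes n: "n \<ge> 1"
    and betti: "betti1 G (arcs G) = n"
    and e: "bij_betw e {..<2 * n} (arcs G)"
    and b: "H1_basis G n b"
    and conv: "\<And>S. S \<noteq> {} \<Longrightarrow> S \<subset> arcs G \<Longrightarrow> convergent_subgraph G S"
begin

text \<open>If the functional of an edge vanished, deleting that edge would keep all
  \<open>n\<close> loops. The nonempty proper subgraph left has \<open>2 * n - 1\<close> edges, too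
  few to be convergent.\<close>

lemma edge_coeff_nonzero:
  assumes "k < 2 * n"
  obtains j where "j < n" "edge_coeff b (e k) j \<noteq> 0"
proof (rule ccontr)
  assume "\<not> thesis"
  then have zero: "\<And>j. j < n \<Longrightarrow> Poly_Mapping.lookup (b j) (e k) = 0"
    using that by (auto simp: edge_coeff_def)
  define S where "S = arcs G - {e k}"
  have fin: "finite (arcs G)" and ek: "e k \<in> arcs G" and card: "card (arcs G) = 2 * n"
    using e assms bij_betw_finite[OF e] bij_betw_same_card[OF e] by (auto simp: bij_betw_def)
  have "b ` {..<n} \<subseteq> H1 G S"
  proof (intro image_subsetI)
    fix j assume "j \<in> {..<n}"
    moreover from this have "b j \<in> H1 G (arcs G)"
      using b frag.span_superset[of "b ` {..<n}"] by (auto simp: H1_basis_def)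
    ultimately show "b j \<in> H1 G S"
      using zero by (auto simp: H1_def S_def in_keys_iff)
  qed
  then have "card (b ` {..<n}) \<le> betti1 G S"
    using b fin by (intro card_le_betti1) (auto simp: S_def H1_basis_def)
  moreover have "card (b ` {..<n}) = n"
    using b by (simp add: H1_basis_def card_image)
  moreover have "card S = 2 * n - 1"
    using fin ek card by (simp add: S_def)
  moreover have "2 * betti1 G S < card S"
  proof -
    have "S \<noteq> {}"
      using \<open>card S = 2 * n - 1\<close> n by (intro notI) simp
    moreover have "S \<subset> arcs G"
      using ek by (auto simp: S_def)
    ultimately show ?thesis
      using conv by (simp add: convergent_subgraph_def)
  qed
  ultimately show False
    by linarith
qed

text \<open>The greedy basis for the edges sorted by decreasing parameter depends on
  \<open>a\<close>, but the resulting bound does not mention it. The ratio \<open>a i / a j\<close>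
  may be any, because all are at most the largest parameter over the smallest.\<close>

lemma edge_gram_bounds:
  assumes pos: "\<And>k. k < 2 * n \<Longrightarrow> a k > 0"
  shows pos_def_edge_gram: "pos_def n (edge_gram n b e a)"
    and det_edge_gram_ge: "i < 2 * n \<Longrightarrow> j < 2 * n \<Longrightarrow>
      (\<Prod>k<2 * n. a k) * (a i / a j) \<le> (det (mat n n (\<lambda>(i, j). edge_gram n b e a i j)))\<^sup>2"
proof -
  obtain \<pi> where \<pi>: "bij_betw \<pi> {..<2 * n} {..<2 * n}"
    "\<And>i j. i \<le> j \<Longrightarrow> j < 2 * n \<Longrightarrow> a (\<pi> j) \<le> a (\<pi> i)"
    using decreasing_enumeration[of "2 * n" a] by blast
  have e': "bij_betw (e \<circ> \<pi>) {..<2 * n} (arcs G)"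
    by (rule bij_betw_trans[OF \<pi>(1) e])
  obtain \<gamma> where \<gamma>: "inj_on \<gamma> {..<n}" "\<gamma> ` {..<n} \<subseteq> {..<2 * n}"
    "det (mat n n (\<lambda>(i, j). Poly_Mapping.lookup (b j) ((e \<circ> \<pi>) (\<gamma> i)))) \<noteq> 0"
    "\<And>m. 0 < m \<Longrightarrow> m < 2 * n \<Longrightarrow> m < 2 * card (\<gamma> ` {..<n} \<inter> {..<m})"
    using greedy_edge_basis[OF betti e' b conv] by blast
  define \<beta> where "\<beta> = \<pi> \<circ> \<gamma>"
  have \<beta>: "inj_on \<beta> {..<n}" "\<beta> ` {..<n} \<subseteq> {..<2 * n}"
    "det (mat n n (\<lambda>(i, j). Poly_Mapping.lookup (b j) (e (\<beta> i)))) \<noteq> 0"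
  proof -
    show "inj_on \<beta> {..<n}"
      unfolding \<beta>_def
      by (rule comp_inj_on[OF \<gamma>(1) inj_on_subset[OF bij_betw_imp_inj_on[OF \<pi>(1)] \<gamma>(2)]])
    show "\<beta> ` {..<n} \<subseteq> {..<2 * n}"
      unfolding \<beta>_def image_comp[symmetric]
      using image_mono[OF \<gamma>(2), of \<pi>] bij_betw_imp_surj_on[OF \<pi>(1)] by simp
    show "det (mat n n (\<lambda>(i, j). Poly_Mapping.lookup (b j) (e (\<beta> i)))) \<noteq> 0"
      using \<gamma>(3) by (simp add: \<beta>_def)
  qed
  show "pos_def n (edge_gram n b e a)"
    by (rule pos_def_edge_gram_basis[OF \<beta> pos])
  assume ij: "i < 2 * n" "j < 2 * n"
  define x where "x k = ln (a (\<pi> k))" for k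
  define B where "B = \<gamma> ` {..<n}"
  \<comment> \<open>With these signs the sum of \<open>c k * x k\<close> is the logarithm of the
    squared basis monomial over the product of all parameters. The greedy property says that its
    partial sums are positive integers, and \<open>card B = n\<close> makes the total 0.\<close>
  define c where "c k = (if k \<in> B then 1 else - 1 :: real)" for k
  have \<pi>_less: "\<pi> k < 2 * n" if "k < 2 * n" for k
    using \<pi>(1) that by (auto simp: bij_betw_def)
  have sum_c: "(\<Sum>k<m. c k * f k) = 2 * (\<Sum>k\<in>B \<inter> {..<m}. f k) - (\<Sum>k<m. f k)" for m f
  proof -
    have "(\<Sum>k<m. c k * f k) = (\<Sum>k<m. 2 * (if k \<in> B then f k else 0) - f k)"
      by (intro sum.cong) (auto simp: c_def)
    also have "\<dots> = 2 * (\<Sum>k<m. if k \<in> B then f k else 0) - (\<Sum>k<m. f k)"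
      by (simp add: sum_subtractf sum_distrib_left)
    also have "(\<Sum>k<m. if k \<in> B then f k else 0) = (\<Sum>k\<in>B \<inter> {..<m}. f k)"
      by (simp add: sum.inter_restrict[symmetric] Int_commute)
    finally show ?thesis .
  qed
  have BN: "B \<inter> {..<2 * n} = B"
    using \<gamma>(2) by (auto simp: B_def)
  have "x 0 - x (2 * n - 1) \<le> (\<Sum>k<2 * n. c k * x k)"
  proof (rule summation_by_parts_bound)
    show "x (Suc k) \<le> x k" if "Suc k < 2 * n" for k
      using \<pi>(2)[of k "Suc k"] that pos \<pi>_less by (simp add: x_def)
    show "1 \<le> (\<Sum>k<m. c k)" if "0 < m" "m < 2 * n" for m
      using sum_c[of "\<lambda>_. 1" m] \<gamma>(4)[OF that] by (simp add: B_def)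
    show "(\<Sum>k<2 * n. c k) = 0"
      using sum_c[of "\<lambda>_. 1" "2 * n"] \<gamma>(1) BN by (simp add: B_def card_image)
  qed (use n in simp)
  also have "\<dots> = 2 * (\<Sum>i<n. ln (a (\<beta> i))) - (\<Sum>k<2 * n. ln (a k))"
  proof -
    have "(\<Sum>k\<in>B. x k) = (\<Sum>i<n. ln (a (\<beta> i)))"
      using \<gamma>(1) by (simp add: B_def x_def \<beta>_def sum.reindex)
    moreover have "(\<Sum>k<2 * n. x k) = (\<Sum>k<2 * n. ln (a k))"
      unfolding x_def by (rule sum.reindex_bij_betw[OF \<pi>(1)])
    ultimately show ?thesis
      by (simp add: sum_c BN)
  qed
  finally have bound: "x 0 - x (2 * n - 1) \<le> 2 * (\<Sum>i<n. ln (a (\<beta> i))) - (\<Sum>k<2 * n. ln (a k))" .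
  have "\<exists>k'<2 * n. k = \<pi> k'" if "k < 2 * n" for k
    using bij_betw_imp_surj_on[OF \<pi>(1)] that by (metis imageE lessThan_iff)
  then obtain i' j' where ij': "i' < 2 * n" "i = \<pi> i'" "j' < 2 * n" "j = \<pi> j'"
    using ij by meson
  \<comment> \<open>In the sorted order the extreme logarithms are those at positions 0 and
    \<open>2 * n - 1\<close>.\<close>
  have "ln (a i) \<le> x 0" "x (2 * n - 1) \<le> ln (a j)"
    using \<pi>(2)[of 0 i'] \<pi>(2)[of j' "2 * n - 1"] ij' pos \<pi>_less n by (auto simp: x_def)
  with bound have "(\<Sum>k<2 * n. ln (a k)) + (ln (a i) - ln (a j)) \<le> 2 * (\<Sum>i<n. ln (a (\<beta> i)))"
    by linarith
  then have "exp ((\<Sum>k<2 * n. ln (a k)) + (ln (a i) - ln (a j))) \<le> exp (2 * (\<Sum>i<n. ln (a (\<beta> i))))"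
    by simp
  moreover have "exp (\<Sum>k<2 * n. ln (a k)) = (\<Prod>k<2 * n. a k)"
    using pos by (simp add: exp_sum)
  moreover have "exp (\<Sum>i<n. ln (a (\<beta> i))) = (\<Prod>i<n. a (\<beta> i))"
    using pos \<beta>(2) by (auto simp: exp_sum intro!: prod.cong exp_ln)
  ultimately have "(\<Prod>k<2 * n. a k) * (a i / a j) \<le> (\<Prod>i<n. a (\<beta> i))\<^sup>2"
    using pos ij by (simp add: exp_add exp_diff exp_double)
  also have "\<dots> \<le> (det (mat n n (\<lambda>(i, j). edge_gram n b e a i j)))\<^sup>2"
  proof (rule power_mono)
    show "(\<Prod>i<n. a (\<beta> i)) \<le> det (mat n n (\<lambda>(i, j). edge_gram n b e a i j))"
      using det_edge_gram_ge_basis[OF \<beta> pos] n by simp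
    show "0 \<le> (\<Prod>i<n. a (\<beta> i))"
      using pos \<beta>(2) by (intro prod_nonneg) (auto intro: less_imp_le)
  qed
  finally show "(\<Prod>k<2 * n. a k) * (a i / a j) \<le> (det (mat n n (\<lambda>(i, j). edge_gram n b e a i j)))\<^sup>2" .
qed

end

section \<open>Convergence of the parametric integral\<close>

text \<open>The bound is applied to the coordinate with the largest
  \<open>\<bar>ln (a i)\<bar>\<close>. That maximum is at least the mean over all coordinates, so
  the integrand is dominated by a product of one-variable functions with finite integrals.\<close>

lemma nn_integral_inverse_finite:
  fixes f :: "(nat \<Rightarrow> real) \<Rightarrow> real"
  assumes "0 < r"
    and bound: "\<And>a i. (\<And>k. k < r \<Longrightarrow> a k > 0) \<Longrightarrow> i < r \<Longrightarrow> (\<Prod>k<r. a k) * exp \<bar>ln (a i)\<bar> \<le> f a"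
  shows "(\<integral>\<^sup>+a. (\<Prod>k<r. indicator {0<..} (a k)) * ennreal (1 / f a) \<partial>(\<Pi>\<^sub>M k\<in>{..<r}. lborel)) < \<infinity>"
proof -
  interpret product_sigma_finite "\<lambda>_::nat. lborel :: real measure"
    by (rule product_sigma_finite_lborel)
  \<comment> \<open>The weight of each coordinate in the mean.\<close>
  define \<epsilon> where "\<epsilon> = 1 / real r"
  define g where "g s = ennreal (indicator {0<..} s * (exp (- \<epsilon> * \<bar>ln s\<bar>) / s))" for s :: real
  have [measurable]: "g \<in> borel_measurable borel"
    unfolding g_def by measurable
  have "(\<Prod>k<r. indicator {0<..} (a k)) * ennreal (1 / f a) \<le> (\<Prod>k<r. g (a k))" for a
  proof (cases "\<forall>k<r. a k > 0")
    case True
    then have prod_pos: "(\<Prod>k<r. a k) > 0"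
      by (intro prod_pos) auto
    obtain i where i: "i < r" "\<And>k. k < r \<Longrightarrow> \<bar>ln (a k)\<bar> \<le> \<bar>ln (a i)\<bar>"
    proof -
      let ?H = "(\<lambda>k. \<bar>ln (a k)\<bar>) ` {..<r}"
      have "Max ?H \<in> ?H"
        using assms(1) by (intro Max_in) auto
      then obtain i where "i < r" "\<bar>ln (a i)\<bar> = Max ?H"
        by auto
      then show thesis
        by (intro that[of i]) auto
    qed
    have "(\<Sum>k<r. \<epsilon> * \<bar>ln (a k)\<bar>) \<le> (\<Sum>k<r. \<epsilon> * \<bar>ln (a i)\<bar>)"
      using i assms(1) by (intro sum_mono mult_left_mono) (auto simp: \<epsilon>_def)
    also have "\<dots> = \<bar>ln (a i)\<bar>"
      using assms(1) by (simp add: \<epsilon>_def)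
    finally have "(\<Prod>k<r. a k) * exp (\<Sum>k<r. \<epsilon> * \<bar>ln (a k)\<bar>) \<le> (\<Prod>k<r. a k) * exp \<bar>ln (a i)\<bar>"
      using prod_pos by simp
    also have "\<dots> \<le> f a"
      using True i by (intro bound) auto
    finally have "1 / f a \<le> 1 / ((\<Prod>k<r. a k) * exp (\<Sum>k<r. \<epsilon> * \<bar>ln (a k)\<bar>))"
      using prod_pos by (intro frac_le) auto
    also have "\<dots> = (\<Prod>k<r. exp (- \<epsilon> * \<bar>ln (a k)\<bar>) / a k)"
      by (simp add: prod_dividef exp_sum exp_minus prod_inversef prod.distrib field_simps)
    finally have "ennreal (1 / f a) \<le> ennreal (\<Prod>k<r. exp (- \<epsilon> * \<bar>ln (a k)\<bar>) / a k)"
      by (rule ennreal_leI)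
    also have "\<dots> = (\<Prod>k<r. ennreal (exp (- \<epsilon> * \<bar>ln (a k)\<bar>) / a k))"
      using True by (intro prod_ennreal[symmetric]) (auto intro!: divide_nonneg_pos)
    also have "\<dots> = (\<Prod>k<r. g (a k))"
      using True by (intro prod.cong) (auto simp: g_def)
    finally show ?thesis
      using True by simp
  next
    case False
    then have zero: "(\<Prod>k<r. indicator {0<..} (a k)) = (0 :: ennreal)"
      by (intro prod_zero) (auto simp: indicator_def)
    show ?thesis
      unfolding zero by simp
  qed
  then have "(\<integral>\<^sup>+a. (\<Prod>k<r. indicator {0<..} (a k)) * ennreal (1 / f a) \<partial>(\<Pi>\<^sub>M k\<in>{..<r}. lborel)) \<le>
      (\<integral>\<^sup>+a. (\<Prod>k<r. g (a k)) \<partial>(\<Pi>\<^sub>M k\<in>{..<r}. lborel))"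
    by (intro nn_integral_mono)
  also have "\<dots> = (\<Prod>k<r. \<integral>\<^sup>+s. g s \<partial>lborel)"
    by (rule product_nn_integral_prod) auto
  also have "\<dots> < \<infinity>"
    using nn_integral_log_decay[of \<epsilon>] assms(1)
    by (simp add: g_def \<epsilon>_def power_less_top_ennreal)
  finally show ?thesis .
qed

section \<open>Integrals in the affine chart\<close>

lemma chart_index: "k < m \<Longrightarrow> chart m x $ k = (if k < m - 1 then x k else 1)"
  by (simp add: chart_def)

text \<open>Omitting a column \<open>i < m - 1\<close> leaves row \<open>i\<close> zero, since its
  only nonzero entry was there. The term omitting the last column has the identity as its minor and
  sign \<open>(- 1) ^ m\<close>.\<close>

lemma Omega_chart:
  assumes "m > 0"
  shows "Omega m (chart m x) (unit_vec m) = (- 1) ^ m"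
proof -
  have zero: "det (mat (m - 1) (m - 1) (\<lambda>(r, c). unit_vec m r $ insert_index i c)) = (0 :: real)"
    if "i < m - 1" for i
  proof -
    let ?A = "mat (m - 1) (m - 1) (\<lambda>(r, c). (unit_vec m r :: real vec) $ insert_index i c)"
    have "(\<Prod>r = 0..<m - 1. ?A $$ (r, p r)) = 0" if p: "p permutes {0..<m - 1}" for p
    proof (rule prod_zero)
      have "p i < m - 1"
        using permutes_in_image[OF p, of i] \<open>i < m - 1\<close> by simp
      then have "?A $$ (i, p i) = 0"
        using \<open>i < m - 1\<close> by (auto simp: insert_index_def)
      then show "\<exists>r\<in>{0..<m - 1}. ?A $$ (r, p r) = 0"
        using \<open>i < m - 1\<close> by (intro bexI[of _ i]) auto
    qed simp
    then show ?thesis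
      by (subst det_def'[of _ "m - 1"]) (auto intro!: sum.neutral)
  qed
  have one: "mat (m - 1) (m - 1) (\<lambda>(r, c). (unit_vec m r :: real vec) $ insert_index (m - 1) c) = 1\<^sub>m (m - 1)"
    using assms by (intro eq_matI) (auto simp: insert_index_def)
  have "Omega m (chart m x) (unit_vec m) = (\<Sum>i\<in>{m - 1}. (- 1) ^ Suc i * chart m x $ i *
     det (mat (m - 1) (m - 1) (\<lambda>(r, c). unit_vec m r $ insert_index i c)))"
    unfolding Omega_def using zero assms
    by (intro sum.mono_neutral_right) auto
  also have "\<dots> = (- 1) ^ m"
    using assms by (simp add: one[simplified] chart_index del: power_Suc)
  finally show ?thesis .
qed

text \<open>For even \<open>m\<close> the sign of the pulled back form is positive, so the
  projective integral is an ordinary Lebesgue integral in the chart; for a nonnegative integrand a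
  finite value of the nonnegative integral gives integrability as well.\<close>

lemma proj_integral_nonneg:
  assumes m: "m > 0" "even m" and "I \<ge> 0"
    and meas: "(\<lambda>x. indicator (chart_domain m X) x * f (chart m x)) \<in> borel_measurable (chart_measure m)"
    and nonneg: "\<And>x. f (chart m x) \<ge> 0"
    and I: "(\<integral>\<^sup>+x. ennreal (indicator (chart_domain m X) x * f (chart m x)) \<partial>chart_measure m) = ennreal I"
  shows "proj_integrable m X f" "proj_integral m X f = I"
proof -
  have eq: "indicator (chart_domain m X) x *\<^sub>R proj_integrand m f x =
      indicator (chart_domain m X) x * f (chart m x)" for x
    using m by (simp add: proj_integrand_def Omega_chart)
  have int: "integrable (chart_measure m) (\<lambda>x. indicator (chart_domain m X) x * f (chart m x))"
    using meas nonneg I by (intro integrableI_nonneg) auto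
  then show "proj_integrable m X f"
    unfolding proj_integrable_def set_integrable_def eq .
  have "ennreal (\<integral>x. indicator (chart_domain m X) x * f (chart m x) \<partial>chart_measure m) = ennreal I"
    using nn_integral_eq_integral[OF int] nonneg I by simp
  then show "proj_integral m X f = I"
    unfolding proj_integral_def set_lebesgue_integral_def eq
    using \<open>I \<ge> 0\<close> nonneg by (subst (asm) ennreal_inj) auto
qed

lemma chart_domain_proj_points:
  assumes "m > 0"
  shows "chart_domain m (proj_points m) = space (chart_measure m)"
proof -
  have "chart m x \<noteq> 0\<^sub>v m" for x
    using assms chart_index[of "m - 1" m x] by (auto simp: chart_def dest!: arg_cong[where f = "\<lambda>v. v $ (m - 1)"])
  then show ?thesis
    by (auto simp: chart_domain_def proj_points_def chart_def)
qed

lemma chart_domain_sigma_points: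
  assumes "m > 0"
  shows "chart_domain m (sigma_points m) = {x \<in> space (chart_measure m). \<forall>k<m - 1. 0 \<le> x k}"
proof -
  have "chart m x \<in> sigma_points m \<longleftrightarrow> (\<forall>k<m - 1. 0 \<le> x k)" if "x \<in> space (chart_measure m)" for x
  proof
    assume "chart m x \<in> sigma_points m"
    then obtain t where t: "t \<noteq> 0" "\<And>i. i < m \<Longrightarrow> 0 \<le> (t \<cdot>\<^sub>v chart m x) $ i"
      by (auto simp: sigma_points_def)
    \<comment> \<open>The last chart coordinate is 1, which fixes the sign of the scaling.\<close>
    from t(2)[of "m - 1"] t(1) assms have "t > 0"
      by (simp add: chart_def)
    show "\<forall>k<m - 1. 0 \<le> x k"
    proof (intro allI impI)
      fix k assume "k < m - 1"
      then show "0 \<le> x k"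
        using t(2)[of k] \<open>t > 0\<close> by (simp add: chart_def zero_le_mult_iff)
    qed
  next
    assume *: "\<forall>k<m - 1. 0 \<le> x k"
    have "chart m x \<in> proj_points m"
      using chart_domain_proj_points[OF assms] that by (auto simp: chart_domain_def)
    with * show "chart m x \<in> sigma_points m"
      by (auto simp: sigma_points_def chart_def intro!: exI[of _ 1])
  qed
  then show ?thesis
    by (auto simp: chart_domain_def)
qed

lemma sum_feynman_quadric:
  "(\<Sum>k<2 * n. a k * feynman_quadric n b (e k) Z) =
    quad (4 * n) (block_power n (edge_gram n b e a)) (\<lambda>r. Z $ r)"
proof -
  have entry: "(\<Sum>k<2 * n. a k * block_power n (\<lambda>i j. edge_coeff b (e k) i * edge_coeff b (e k) j) r s) =
      block_power n (edge_gram n b e a) r s" for r s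
    by (simp add: block_power_def edge_gram_def)
  have "(\<Sum>k<2 * n. a k * feynman_quadric n b (e k) Z) =
      (\<Sum>k<2 * n. \<Sum>r<4 * n. \<Sum>s<4 * n.
        a k * block_power n (\<lambda>i j. edge_coeff b (e k) i * edge_coeff b (e k) j) r s * Z $ r * Z $ s)"
    unfolding feynman_quadric_eq by (simp add: sum_distrib_left mult.assoc)
  also have "\<dots> = (\<Sum>r<4 * n. \<Sum>k<2 * n. \<Sum>s<4 * n.
        a k * block_power n (\<lambda>i j. edge_coeff b (e k) i * edge_coeff b (e k) j) r s * Z $ r * Z $ s)"
    by (rule sum.swap)
  also have "\<dots> = (\<Sum>r<4 * n. \<Sum>s<4 * n. \<Sum>k<2 * n.
        a k * block_power n (\<lambda>i j. edge_coeff b (e k) i * edge_coeff b (e k) j) r s * Z $ r * Z $ s)"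
    by (intro sum.cong[OF refl] sum.swap)
  finally show ?thesis
    unfolding quad_def entry[symmetric] sum_distrib_right by simp
qed

lemma pos_def_block_power:
  assumes "pos_def n f" "n > 0"
  shows "pos_def (p * n) (block_power n f)"
  unfolding pos_def_def
proof (intro conjI allI impI)
  show "block_power n f r s = block_power n f s r" for r s
  proof (rule block_power_sym)
    show "f i j = f j i" if "i < n" "j < n" for i j
      using assms(1) that by (simp add: pos_def_def)
  qed (rule assms(2))
  fix v :: "nat \<Rightarrow> real" assume "\<exists>r<p * n. v r \<noteq> 0"
  then obtain r where r: "r < p * n" "v r \<noteq> 0" by blast
  have nonneg: "0 \<le> quad n f w" for w
  proof (cases "\<exists>i<n. w i \<noteq> 0")
    case True
    then show ?thesis
      using assms(1) by (simp add: pos_def_def less_imp_le)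
  next
    case False
    then show ?thesis
      by (simp add: quad_def)
  qed
  have "\<exists>i<n. v (r div n * n + i) \<noteq> 0"
    using r(2) assms(2) by (intro exI[of _ "r mod n"]) simp
  then have "0 < quad n f (\<lambda>i. v (r div n * n + i))"
    using assms(1) by (simp add: pos_def_def)
  then have "0 < (\<Sum>q<p. quad n f (\<lambda>i. v (q * n + i)))"
    using nonneg r assms(2) by (intro sum_pos2[of _ "r div n"]) (auto simp: less_mult_imp_div_less)
  then show "0 < quad (p * n) (block_power n f) v"
    unfolding quad_def block_power_quadratic_form .
qed

text \<open>Moves the homogenizing coordinate from index \<open>m\<close>, where \<open>chart\<close> puts it, to index 0.\<close>

definition rotation :: "nat \<Rightarrow> nat \<Rightarrow> nat" where
  "rotation m i = (if i = 0 then m else if i \<le> m then i - 1 else i)"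

lemma rotation_permutes: "rotation m permutes {0..<Suc m}"
proof (rule bij_imp_permutes)
  show "bij_betw (rotation m) {0..<Suc m} {0..<Suc m}"
    by (rule bij_betw_byWitness[where f' = "\<lambda>i. if i = m then 0 else Suc i"])
      (auto simp: rotation_def)
qed (simp add: rotation_def)

lemma quad_rotation:
  "quad (Suc m) (\<lambda>i j. M (rotation m i) (rotation m j)) (\<lambda>i. w (rotation m i)) = quad (Suc m) M w"
proof -
  have perm: "(\<Sum>i<Suc m. g (rotation m i)) = (\<Sum>i<Suc m. g i)" for g :: "nat \<Rightarrow> real"
    using sum.permute[OF rotation_permutes, of g m] by (simp add: atLeast0LessThan comp_def)
  show ?thesis
    unfolding quad_def
    using perm[of "\<lambda>i. \<Sum>j<Suc m. M i (rotation m j) * w i * w (rotation m j)"]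
    by (simp only: perm[of "\<lambda>j. M i j * w i * w j" for i])
qed

lemma pos_def_rotation:
  assumes "pos_def (Suc m) M"
  shows "pos_def (Suc m) (\<lambda>i j. M (rotation m i) (rotation m j))"
  unfolding pos_def_def
proof (intro conjI allI impI)
  fix i j assume "i < Suc m" "j < Suc m"
  then show "M (rotation m i) (rotation m j) = M (rotation m j) (rotation m i)"
    using assms permutes_in_image[OF rotation_permutes, of m] by (simp add: pos_def_def)
next
  fix v :: "nat \<Rightarrow> real" assume "\<exists>i<Suc m. v i \<noteq> 0"
  then obtain i where i: "i < Suc m" "v i \<noteq> 0" by blast
  define w where "w i = v (inv_into UNIV (rotation m) i)" for i
  have v: "v = (\<lambda>i. w (rotation m i))"
    by (simp add: w_def permutes_inverses(2)[OF rotation_permutes])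
  have "rotation m i < Suc m"
    using i permutes_in_image[OF rotation_permutes, of m i] by simp
  moreover have "w (rotation m i) \<noteq> 0"
    using i(2) fun_cong[OF v, of i] by simp
  ultimately have "0 < quad (Suc m) M w"
    using assms by (auto simp: pos_def_def)
  then show "0 < quad (Suc m) (\<lambda>i j. M (rotation m i) (rotation m j)) v"
    unfolding v quad_rotation .
qed

text \<open>The cone integral with the homogenizing coordinate in last place. Rotating the indices
  of matrix and vector together preserves the value of the form, and the determinant is
  unchanged.\<close>

lemma nn_integral_scaled_gaussian_chart:
  assumes "pos_def (Suc m) M"
  shows "(\<integral>\<^sup>+t. ennreal (indicator {0<..} t * t powr ((real m - 1) / 2)) *
      (\<integral>\<^sup>+x. ennreal (exp (- t * quad (Suc m) M (\<lambda>i. if i < m then x i else 1))) \<partial>(\<Pi>\<^sub>M i\<in>{..<m}. lborel)) \<partial>lborel) =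
    ennreal (sqrt pi ^ Suc m / sqrt (det (mat (Suc m) (Suc m) (\<lambda>(i, j). M i j))))"
proof -
  have "quad (Suc m) (\<lambda>i j. M (rotation m i) (rotation m j)) (case_nat 1 x) =
      quad (Suc m) M (\<lambda>i. if i < m then x i else 1)" for x
  proof -
    have "quad (Suc m) (\<lambda>i j. M (rotation m i) (rotation m j)) (case_nat 1 x) =
        quad (Suc m) (\<lambda>i j. M (rotation m i) (rotation m j)) (\<lambda>i. (\<lambda>i. if i < m then x i else 1) (rotation m i))"
      by (rule quad_cong) (auto simp: rotation_def split: nat.split)
    then show ?thesis
      by (simp only: quad_rotation[of m M "\<lambda>i. if i < m then x i else 1"])
  qed
  then show ?thesis
    using cone_integral_eq(2)[OF pos_def_rotation[OF assms]] det_mat_permute[OF rotation_permutes, of m M]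
    by (simp add: cone_integral_def)
qed

lemma borel_measurable_chart_index:
  assumes "k < m"
  shows "(\<lambda>x. chart m x $ k) \<in> borel_measurable (\<Pi>\<^sub>M i\<in>{..<m - 1}. lborel)"
  using assms by (cases "k < m - 1") (auto simp: chart_index)

lemma borel_measurable_det:
  fixes F :: "'x \<Rightarrow> nat \<Rightarrow> nat \<Rightarrow> real"
  assumes [measurable]: "\<And>i j. i < d \<Longrightarrow> j < d \<Longrightarrow> (\<lambda>x. F x i j) \<in> borel_measurable N"
  shows "(\<lambda>x. det (mat d d (\<lambda>(i, j). F x i j))) \<in> borel_measurable N"
proof -
  have "det (mat d d (\<lambda>(i, j). F x i j)) =
      (\<Sum>p\<in>{p. p permutes {0..<d}}. signof p * (\<Prod>i = 0..<d. F x i (p i)))" for x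
    using permutes_in_image
    by (subst det_def'[of _ d]) (auto intro!: sum.cong prod.cong)
  moreover have "(\<lambda>x. F x i (p i)) \<in> borel_measurable N" if "p permutes {0..<d}" "i < d" for p i
    using permutes_in_image[OF that(1), of i] that(2) by simp
  ultimately show ?thesis
    by simp
qed

text \<open>The faces of the simplex are null, so the weak inequalities of
  \<open>sigma_points\<close> may be replaced by strict ones.\<close>

lemma AE_component_nonzero:
  fixes r :: nat
  shows "AE x in (\<Pi>\<^sub>M k\<in>{..<r}. lborel). \<forall>k<r. x k \<noteq> (0 :: real)"
proof -
  have "AE x in (\<Pi>\<^sub>M k\<in>{..<r}. lborel). x j \<noteq> (0 :: real)" if "j < r" for j
    using AE_PiM_lborel_linear_nonzero[of "{..<r}" j "\<lambda>k. if k = j then 1 else 0"] that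
    by (simp add: if_distrib[where f = "\<lambda>x. x * _"] cong: if_cong)
  then have "AE x in (\<Pi>\<^sub>M k\<in>{..<r}. lborel). \<forall>k\<in>{..<r}. x k \<noteq> (0 :: real)"
    by (intro eventually_ball_finite) auto
  then show ?thesis
    by eventually_elim auto
qed

section \<open>The momentum and parametric integrals of the graph\<close>

context
  fixes G :: "('v, 'e) pre_digraph" and n :: nat and e :: "nat \<Rightarrow> 'e" and b :: "nat \<Rightarrow> 'e \<Rightarrow>\<^sub>0 int"
  assumes n: "n \<ge> 1"
    and betti: "betti1 G (arcs G) = n"
    and e: "bij_betw e {..<2 * n} (arcs G)"
    and b: "H1_basis G n b"
    and conv: "\<And>S. S \<noteq> {} \<Longrightarrow> S \<subset> arcs G \<Longrightarrow> convergent_subgraph G S"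
begin

abbreviation "psi a \<equiv> Psi n b e (chart (2 * n) a)"

text \<open>The last parameter is 1 in the chart. Comparing edge \<open>i\<close> with the last edge
  in both orders gives the factors \<open>a i\<close> and \<open>1 / a i\<close>, the larger of
  which is \<open>exp \<bar>ln (a i)\<bar>\<close>.\<close>

lemma Psi_lower_bound:
  assumes pos: "\<And>k. k < 2 * n - 1 \<Longrightarrow> a k > 0" and i: "i < 2 * n - 1"
  shows "(\<Prod>k<2 * n - 1. a k) * exp \<bar>ln (a i)\<bar> \<le> (psi a)\<^sup>2"
proof -
  let ?A = "\<lambda>k. chart (2 * n) a $ k"
  have A: "?A k = (if k < 2 * n - 1 then a k else 1)" if "k < 2 * n" for k
    using that by (rule chart_index)
  have A_pos: "?A k > 0" if "k < 2 * n" for k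
    using A[OF that] pos by simp
  note ge = det_edge_gram_ge[OF n betti e b conv, of ?A, OF _ _ A_pos, folded Psi_eq]
  have "{..<2 * n} = insert (2 * n - 1) {..<2 * n - 1}"
    using n by auto
  then have prod: "(\<Prod>k<2 * n. ?A k) = (\<Prod>k<2 * n - 1. a k)"
    using n A by simp
  have r: "?A (2 * n - 1) = 1" "?A i = a i" "a i > 0"
    using n i A pos by simp_all
  have "(\<Prod>k<2 * n - 1. a k) * (?A i / ?A (2 * n - 1)) \<le> (psi a)\<^sup>2"
    "(\<Prod>k<2 * n - 1. a k) * (?A (2 * n - 1) / ?A i) \<le> (psi a)\<^sup>2"
    using ge[of i "2 * n - 1"] ge[of "2 * n - 1" i] n i unfolding prod by simp_all
  then show ?thesis
    using r by (cases "ln (a i) \<ge> 0") (simp_all add: exp_minus divide_inverse abs_if)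
qed

text \<open>An extended nonnegative value, so that the momentum integral can be expressed through it
  by Tonelli independently of convergence.\<close>

definition "parametric_nn =
  (\<integral>\<^sup>+a. (\<Prod>k<2 * n - 1. indicator {0<..} (a k)) * ennreal (1 / (psi a)\<^sup>2) \<partial>(\<Pi>\<^sub>M k\<in>{..<2 * n - 1}. lborel))"

lemma parametric_nn_finite: "parametric_nn < \<infinity>"
  unfolding parametric_nn_def
  by (rule nn_integral_inverse_finite) (use n Psi_lower_bound in auto)

lemma borel_measurable_psi [measurable]: "psi \<in> borel_measurable (\<Pi>\<^sub>M k\<in>{..<2 * n - 1}. lborel)"
  unfolding Psi_eq
proof (rule borel_measurable_det)
  fix i j
  show "(\<lambda>a. edge_gram n b e (\<lambda>k. chart (2 * n) a $ k) i j) \<in> borel_measurable (\<Pi>\<^sub>M k\<in>{..<2 * n - 1}. lborel)"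
    unfolding edge_gram_def
    by (intro borel_measurable_sum borel_measurable_times borel_measurable_chart_index) auto
qed

lemma parametric_nn_eq:
  "(\<integral>\<^sup>+a. ennreal (indicator (chart_domain (2 * n) (sigma_points (2 * n))) a *
     parametric_integrand n b e (chart (2 * n) a)) \<partial>chart_measure (2 * n)) = parametric_nn"
  unfolding parametric_nn_def chart_measure_def
proof (rule nn_integral_cong_AE, use AE_component_nonzero AE_space in eventually_elim)
  fix a :: "nat \<Rightarrow> real"
  assume a: "\<forall>k<2 * n - 1. a k \<noteq> 0" "a \<in> space (\<Pi>\<^sub>M k\<in>{..<2 * n - 1}. lborel)"
  show "ennreal (indicator (chart_domain (2 * n) (sigma_points (2 * n))) a *
      parametric_integrand n b e (chart (2 * n) a)) =
    (\<Prod>k<2 * n - 1. indicator {0<..} (a k)) * ennreal (1 / (psi a)\<^sup>2)"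
  proof (cases "\<forall>k<2 * n - 1. a k > 0")
    case True
    then have "a \<in> chart_domain (2 * n) (sigma_points (2 * n))"
      using a(2) n by (auto simp: chart_domain_sigma_points chart_measure_def intro: less_imp_le)
    with True show ?thesis
      by (simp add: parametric_integrand_def)
  next
    case False
    then obtain k where k: "k < 2 * n - 1" "\<not> 0 \<le> a k"
      using a(1) by (metis order_le_less)
    then have "a \<notin> chart_domain (2 * n) (sigma_points (2 * n))"
      using n by (auto simp: chart_domain_sigma_points)
    moreover from k have "(\<Prod>k<2 * n - 1. indicator {0<..} (a k)) = (0 :: ennreal)"
      by (intro prod_zero) (auto simp: indicator_def intro!: bexI[of _ k])
    ultimately show ?thesis
      by simp
  qed
qed

lemma borel_measurable_feynman_quadric:
  "(\<lambda>x. feynman_quadric n b a (chart (4 * n) x)) \<in> borel_measurable (\<Pi>\<^sub>M i\<in>{..<4 * n - 1}. lborel)"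
  unfolding feynman_quadric_eq
  by (intro borel_measurable_sum borel_measurable_times borel_measurable_chart_index) auto

text \<open>The first of the four squares is already positive almost everywhere: the edge functional
  is nonzero, and \<open>n \<le> 4 * n - 1\<close> keeps the coordinates of the first vector clear
  of the coordinate fixed to 1.\<close>

lemma AE_feynman_quadric_pos:
  "AE x in (\<Pi>\<^sub>M i\<in>{..<4 * n - 1}. lborel). \<forall>k<2 * n. feynman_quadric n b (e k) (chart (4 * n) x) > 0"
proof -
  have "AE x in (\<Pi>\<^sub>M i\<in>{..<4 * n - 1}. lborel). feynman_quadric n b (e k) (chart (4 * n) x) > 0"
    if k: "k < 2 * n" for k
  proof -
    obtain j where j: "j < n" "edge_coeff b (e k) j \<noteq> 0"
      using edge_coeff_nonzero[OF n betti e b conv k] by blast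
    have "AE x in (\<Pi>\<^sub>M i\<in>{..<4 * n - 1}. lborel).
        (\<Sum>i<4 * n - 1. (if i < n then edge_coeff b (e k) i else 0) * x i) \<noteq> (0 :: real)"
      by (rule AE_PiM_lborel_linear_nonzero[of _ j]) (use j in auto)
    then show ?thesis
    proof eventually_elim
      case (elim x)
      have "edge_form n b (e k) (vec n (\<lambda>j. chart (4 * n) x $ (0 * n + j))) =
          (\<Sum>i<n. edge_coeff b (e k) i * x i)"
        using n by (auto simp: edge_form_def edge_coeff_def chart_index intro!: sum.cong)
      also have "\<dots> = (\<Sum>i<4 * n - 1. (if i < n then edge_coeff b (e k) i else 0) * x i)"
        using n by (intro sum.mono_neutral_cong_left) auto
      finally have "edge_form n b (e k) (vec n (\<lambda>j. chart (4 * n) x $ (0 * n + j))) \<noteq> 0"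
        using elim by simp
      then show ?case
        unfolding feynman_quadric_def by (intro sum_pos2[of _ 0]) auto
    qed
  qed
  then have "AE x in (\<Pi>\<^sub>M i\<in>{..<4 * n - 1}. lborel).
      \<forall>k\<in>{..<2 * n}. feynman_quadric n b (e k) (chart (4 * n) x) > 0"
    by (intro eventually_ball_finite) auto
  then show ?thesis
    by eventually_elim auto
qed

text \<open>For fixed positive parameters the integral over scale and momenta is a Gaussian integral
  in cone coordinates. Its determinant is the fourth power of \<open>psi a\<close>, whose square
  root is the denominator of the parametric integrand.\<close>

lemma momentum_inner:
  assumes pos: "\<And>k. k < 2 * n - 1 \<Longrightarrow> a k > 0"
  shows "(\<integral>\<^sup>+t. ennreal (indicator {0<..} t * t ^ (2 * n - 1)) *
      (\<integral>\<^sup>+x. ennreal (exp (- t * ((\<Sum>k<2 * n - 1. a k * feynman_quadric n b (e k) (chart (4 * n) x)) +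
          feynman_quadric n b (e (2 * n - 1)) (chart (4 * n) x)))) \<partial>(\<Pi>\<^sub>M i\<in>{..<4 * n - 1}. lborel)) \<partial>lborel) =
    ennreal (pi ^ (2 * n)) * ennreal (1 / (psi a)\<^sup>2)"
proof -
  let ?A = "\<lambda>k. chart (2 * n) a $ k"
  let ?M = "block_power n (edge_gram n b e ?A)"
  have A: "?A k = (if k < 2 * n - 1 then a k else 1)" if "k < 2 * n" for k
    using that by (rule chart_index)
  have m: "Suc (4 * n - 1) = 4 * n"
    using n by simp
  have ins: "{..<2 * n} = insert (2 * n - 1) {..<2 * n - 1}"
    using n by auto
  have "pos_def n (edge_gram n b e ?A)"
    by (rule pos_def_edge_gram[OF n betti e b conv]) (use A pos in auto)
  then have pd: "pos_def (4 * n) ?M"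
    using n by (intro pos_def_block_power) auto
  have quad: "(\<Sum>k<2 * n - 1. a k * feynman_quadric n b (e k) (chart (4 * n) x)) +
      feynman_quadric n b (e (2 * n - 1)) (chart (4 * n) x) =
    quad (4 * n) ?M (\<lambda>i. if i < 4 * n - 1 then x i else 1)" for x
  proof -
    have "(\<Sum>k<2 * n - 1. a k * feynman_quadric n b (e k) (chart (4 * n) x)) +
        feynman_quadric n b (e (2 * n - 1)) (chart (4 * n) x) =
      (\<Sum>k<2 * n. ?A k * feynman_quadric n b (e k) (chart (4 * n) x))"
      unfolding ins using n A by simp
    also have "\<dots> = quad (4 * n) ?M (\<lambda>i. chart (4 * n) x $ i)"
      by (rule sum_feynman_quadric)
    also have "\<dots> = quad (4 * n) ?M (\<lambda>i. if i < 4 * n - 1 then x i else 1)"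
      by (rule quad_cong) (rule chart_index)
    finally show ?thesis .
  qed
  \<comment> \<open>Here \<open>2 * n\<close> edges and \<open>n\<close> loops match: the power of
    \<open>t\<close> from Feynman's parametrization is exactly the radial weight of the cone in
    dimension \<open>4 * n\<close>.\<close>
  have exponent: "indicator {0<..} t * t ^ (2 * n - 1) =
      indicator {0<..} t * t powr ((real (4 * n - 1) - 1) / 2)" for t :: real
  proof -
    have "(real (4 * n - 1) - 1) / 2 = real (2 * n - 1)"
      using n by (simp add: of_nat_diff)
    then show ?thesis
      by (cases "t > 0") (simp_all only: powr_realpow, simp)
  qed
  have "(\<integral>\<^sup>+t. ennreal (indicator {0<..} t * t ^ (2 * n - 1)) *
      (\<integral>\<^sup>+x. ennreal (exp (- t * ((\<Sum>k<2 * n - 1. a k * feynman_quadric n b (e k) (chart (4 * n) x)) +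
          feynman_quadric n b (e (2 * n - 1)) (chart (4 * n) x)))) \<partial>(\<Pi>\<^sub>M i\<in>{..<4 * n - 1}. lborel)) \<partial>lborel) =
    ennreal (sqrt pi ^ (4 * n) / sqrt (det (mat (4 * n) (4 * n) (\<lambda>(i, j). ?M i j))))"
    unfolding quad exponent using nn_integral_scaled_gaussian_chart[of "4 * n - 1" ?M] pd
    unfolding m by simp
  also have "sqrt (det (mat (4 * n) (4 * n) (\<lambda>(i, j). ?M i j))) = (psi a)\<^sup>2"
  proof -
    have "det (mat (4 * n) (4 * n) (\<lambda>(i, j). ?M i j)) = ((psi a)\<^sup>2)\<^sup>2"
      using n det_block_power[of n 4 "edge_gram n b e ?A"] by (simp add: Psi_eq)
    then show ?thesis
      by (simp only: real_sqrt_abs abs_power2)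
  qed
  also have "sqrt pi ^ (4 * n) = pi ^ (2 * n)"
  proof -
    have "sqrt pi ^ (4 * n) = ((sqrt pi)\<^sup>2) ^ (2 * n)"
      unfolding power_mult[symmetric] by simp
    then show ?thesis
      by simp
  qed
  finally show ?thesis
    by (simp add: ennreal_mult[symmetric])
qed

lemma momentum_nn_eq:
  "(\<integral>\<^sup>+x. ennreal (momentum_integrand n b e (chart (4 * n) x)) \<partial>chart_measure (4 * n)) =
    ennreal (pi ^ (2 * n)) * parametric_nn"
proof -
  let ?N = "\<Pi>\<^sub>M i\<in>{..<4 * n - 1}. (lborel :: real measure)" and ?r = "2 * n - 1"
  let ?q = "\<lambda>k x. feynman_quadric n b (e k) (chart (4 * n) x)"
  have Suc: "Suc ?r = 2 * n"
    using n by simp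
  have "(\<integral>\<^sup>+x. ennreal (momentum_integrand n b e (chart (4 * n) x)) \<partial>chart_measure (4 * n)) =
      (\<integral>\<^sup>+x. ennreal (1 / (\<Prod>k<Suc ?r. ?q k x)) \<partial>?N)"
    unfolding Suc by (simp add: momentum_integrand_def chart_measure_def)
  also have "\<dots> = (\<integral>\<^sup>+a. (\<Prod>k<?r. indicator {0<..} (a k)) *
       (\<integral>\<^sup>+t. ennreal (indicator {0<..} t * t ^ ?r) *
         (\<integral>\<^sup>+x. ennreal (exp (- t * ((\<Sum>k<?r. a k * ?q k x) + ?q ?r x))) \<partial>?N) \<partial>lborel)
     \<partial>(\<Pi>\<^sub>M k\<in>{..<?r}. lborel))"
  proof (rule nn_integral_schwinger[OF sigma_finite_PiM_lborel borel_measurable_feynman_quadric])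
    show "AE x in ?N. \<forall>k\<le>?r. 0 < ?q k x"
      using AE_feynman_quadric_pos by eventually_elim (use n in auto)
  qed simp
  also have "\<dots> = (\<integral>\<^sup>+a. ennreal (pi ^ (2 * n)) *
      ((\<Prod>k<?r. indicator {0<..} (a k)) * ennreal (1 / (psi a)\<^sup>2)) \<partial>(\<Pi>\<^sub>M k\<in>{..<?r}. lborel))"
  proof (rule nn_integral_cong)
    fix a :: "nat \<Rightarrow> real"
    show "(\<Prod>k<?r. indicator {0<..} (a k)) *
       (\<integral>\<^sup>+t. ennreal (indicator {0<..} t * t ^ ?r) *
         (\<integral>\<^sup>+x. ennreal (exp (- t * ((\<Sum>k<?r. a k * ?q k x) + ?q ?r x))) \<partial>?N) \<partial>lborel) =
      ennreal (pi ^ (2 * n)) * ((\<Prod>k<?r. indicator {0<..} (a k)) * ennreal (1 / (psi a)\<^sup>2))"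
    proof (cases "\<forall>k<?r. a k > 0")
      case True
      then show ?thesis
        by (subst momentum_inner) (auto simp: mult.left_commute)
    next
      case False
      then have zero: "(\<Prod>k<?r. indicator {0<..} (a k)) = (0 :: ennreal)"
        by (intro prod_zero) (auto simp: indicator_def)
      show ?thesis
        unfolding zero by simp
    qed
  qed
  also have "\<dots> = ennreal (pi ^ (2 * n)) * parametric_nn"
    unfolding parametric_nn_def by (rule nn_integral_cmult) measurable
  finally show ?thesis .
qed

lemma projective_integrals:
  shows "proj_integrable (4 * n) (proj_points (4 * n)) (momentum_integrand n b e)"
    and "proj_integrable (2 * n) (sigma_points (2 * n)) (parametric_integrand n b e)"
    and "proj_integral (4 * n) (proj_points (4 * n)) (momentum_integrand n b e) =
      pi ^ (2 * n) * proj_integral (2 * n) (sigma_points (2 * n)) (parametric_integrand n b e)"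
proof -
  obtain I where I: "I \<ge> 0" "parametric_nn = ennreal I"
    using parametric_nn_finite by (cases parametric_nn) auto
  have dom: "chart_domain (2 * n) (sigma_points (2 * n)) \<in> sets (chart_measure (2 * n))"
  proof -
    have "{x \<in> space (\<Pi>\<^sub>M k\<in>{..<2 * n - 1}. lborel). \<forall>k\<in>{..<2 * n - 1}. (0 :: real) \<le> x k}
        \<in> sets (\<Pi>\<^sub>M k\<in>{..<2 * n - 1}. lborel)"
      by measurable
    then show ?thesis
      using n by (simp add: chart_domain_sigma_points chart_measure_def Ball_def)
  qed
  have par_meas: "(\<lambda>x. indicator (chart_domain (2 * n) (sigma_points (2 * n))) x *
      parametric_integrand n b e (chart (2 * n) x)) \<in> borel_measurable (chart_measure (2 * n))"
    using dom borel_measurable_psi unfolding parametric_integrand_def chart_measure_def by measurable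
  have par_nonneg: "parametric_integrand n b e (chart (2 * n) x) \<ge> 0" for x
    by (simp add: parametric_integrand_def)
  \<comment> \<open>Both dimensions are even, so neither chart introduces a sign.\<close>
  have n2: "2 * n > 0" "even (2 * n)" and n4: "4 * n > 0" "even (4 * n)"
    using n by simp_all
  note par = proj_integral_nonneg[OF n2 I(1) par_meas par_nonneg parametric_nn_eq[unfolded I(2)]]
  have ind: "indicator (chart_domain (4 * n) (proj_points (4 * n))) x * momentum_integrand n b e (chart (4 * n) x) =
      momentum_integrand n b e (chart (4 * n) x)" if "x \<in> space (chart_measure (4 * n))" for x
    using that n by (simp add: chart_domain_proj_points)
  have "(\<lambda>x. momentum_integrand n b e (chart (4 * n) x)) \<in> borel_measurable (chart_measure (4 * n))"
    unfolding momentum_integrand_def chart_measure_def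
    by (intro borel_measurable_divide borel_measurable_prod borel_measurable_feynman_quadric) auto
  then have mom_meas: "(\<lambda>x. indicator (chart_domain (4 * n) (proj_points (4 * n))) x *
      momentum_integrand n b e (chart (4 * n) x)) \<in> borel_measurable (chart_measure (4 * n))"
    by (subst measurable_cong[OF ind])
  have mom_nonneg: "momentum_integrand n b e (chart (4 * n) x) \<ge> 0" for x
    by (auto simp: momentum_integrand_def feynman_quadric_def intro!: prod_nonneg sum_nonneg)
  have "(\<integral>\<^sup>+x. ennreal (indicator (chart_domain (4 * n) (proj_points (4 * n))) x *
      momentum_integrand n b e (chart (4 * n) x)) \<partial>chart_measure (4 * n)) =
    (\<integral>\<^sup>+x. ennreal (momentum_integrand n b e (chart (4 * n) x)) \<partial>chart_measure (4 * n))"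
    by (intro nn_integral_cong) (simp only: ind)
  also have "\<dots> = ennreal (pi ^ (2 * n) * I)"
    unfolding momentum_nn_eq I(2) using I(1) by (intro ennreal_mult[symmetric]) auto
  finally have mom_int: "(\<integral>\<^sup>+x. ennreal (indicator (chart_domain (4 * n) (proj_points (4 * n))) x *
      momentum_integrand n b e (chart (4 * n) x)) \<partial>chart_measure (4 * n)) = ennreal (pi ^ (2 * n) * I)" .
  have "0 \<le> pi ^ (2 * n) * I"
    using I(1) by simp
  note mom = proj_integral_nonneg[OF n4 this mom_meas mom_nonneg mom_int]
  show "proj_integrable (4 * n) (proj_points (4 * n)) (momentum_integrand n b e)"
    "proj_integrable (2 * n) (sigma_points (2 * n)) (parametric_integrand n b e)"
    "proj_integral (4 * n) (proj_points (4 * n)) (momentum_integrand n b e) =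
      pi ^ (2 * n) * proj_integral (2 * n) (sigma_points (2 * n)) (parametric_integrand n b e)"
    using par mom by simp_all
qed

end

theorem corollary6p3:
  fixes G :: "('v, 'e) pre_digraph"
    and n :: nat
    and e :: "nat \<Rightarrow> 'e"
    and b :: "nat \<Rightarrow> 'e \<Rightarrow>\<^sub>0 int"
  assumes "fin_digraph G"
    and "n \<ge> 1"
    and "betti1 G (arcs G) = n"
    and "bij_betw e {..<2 * n} (arcs G)"
    and "H1_basis G n b"
    and "\<And>S. S \<noteq> {} \<Longrightarrow> S \<subset> arcs G \<Longrightarrow> convergent_subgraph G S"
  shows "(\<forall>i<2 * n. M_mat n b (e i) =
            diag_block_mat [N_mat n b (e i), N_mat n b (e i), N_mat n b (e i), N_mat n b (e i)])
    \<and> (\<forall>A\<in>carrier_vec (2 * n). Phi n b e A = Psi n b e A ^ 4)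
    \<and> proj_integrable (4 * n) (proj_points (4 * n)) (momentum_integrand n b e)
    \<and> proj_integrable (2 * n) (sigma_points (2 * n)) (parametric_integrand n b e)
    \<and> (\<exists>c\<in>\<rat>. c \<noteq> 0 \<and>
          proj_integral (4 * n) (proj_points (4 * n)) (momentum_integrand n b e) =
          c * pi ^ (2 * n) * proj_integral (2 * n) (sigma_points (2 * n)) (parametric_integrand n b e))"
proof (intro conjI)
  have "n > 0"
    using assms(2) by simp
  then show "\<forall>i<2 * n. M_mat n b (e i) =
      diag_block_mat [N_mat n b (e i), N_mat n b (e i), N_mat n b (e i), N_mat n b (e i)]"
    and "\<forall>A\<in>carrier_vec (2 * n). Phi n b e A = Psi n b e A ^ 4"
    by (simp_all only: M_mat_block Phi_eq_Psi_power) simp_all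
  have "proj_integral (4 * n) (proj_points (4 * n)) (momentum_integrand n b e) =
      1 * pi ^ (2 * n) * proj_integral (2 * n) (sigma_points (2 * n)) (parametric_integrand n b e)"
    using projective_integrals(3)[OF assms(2-6)] by simp
  then show "\<exists>c\<in>\<rat>. c \<noteq> 0 \<and>
      proj_integral (4 * n) (proj_points (4 * n)) (momentum_integrand n b e) =
      c * pi ^ (2 * n) * proj_integral (2 * n) (sigma_points (2 * n)) (parametric_integrand n b e)"
    by (rule_tac bexI[of _ 1]) simp_all
  show "proj_integrable (4 * n) (proj_points (4 * n)) (momentum_integrand n b e)"
    by (rule projective_integrals(1)[OF assms(2-6)])
  show "proj_integrable (2 * n) (sigma_points (2 * n)) (parametric_integrand n b e)"
    by (rule projective_integrals(2)[OF assms(2-6)])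
qed

end
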